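(* Let $G$ be a simple graph of order $n\geq 4$ such that both $G$ and its complement $\overline{G}$ are connected. Then $trc(G)+trc(\overline{G})=2n+2$ if $n=4$; $trc(G)+trc(\overline{G})\leq 2n+1$ if $n=5$; and $trc(G)+trc(\overline{G})\leq 2n$ if $n\geq 6$. Moreover, these upper bounds are tight: for every $n\geq 5$ there exists a graph $G$ of order $n$ with $G$ and $\overline{G}$ connected attaining the corresponding bound.
   Context: All graphs are finite, simple and undirected. A total-coloring of a graph assigns colors to all its vertices and edges. In a total-colored graph, a path is total-rainbow if all its edges and all its internal vertices receive pairwise distinct colors. The graph is total-rainbow connected if every pair of distinct vertices is joined by a total-rainbow path. For a connected graph $G$, the total-rainbow connection number $trc(G)$ is the minimum number of colors in a total-coloring of $G$ making $G$ total-rainbow connected. *)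

theory Defs
  imports Complex_Main
begin

definition simple_graph :: "'a set \<Rightarrow> 'a set set \<Rightarrow> bool" where
  "simple_graph V E \<longleftrightarrow> finite V \<and> (\<forall>e\<in>E. e \<subseteq> V \<and> card e = 2)"

definition complement_edges :: "'a set \<Rightarrow> 'a set set \<Rightarrow> 'a set set" where
  "complement_edges V E = {e. e \<subseteq> V \<and> card e = 2 \<and> e \<notin> E}"

fun path_edges :: "'a list \<Rightarrow> 'a set list" where
  "path_edges (u # v # p) = {u, v} # path_edges (v # p)"
| "path_edges _ = []"

definition internal_vertices :: "'a list \<Rightarrow> 'a list" where
  "internal_vertices p = butlast (tl p)"

definition path_between :: "'a set \<Rightarrow> 'a set set \<Rightarrow> 'a \<Rightarrow> 'a list \<Rightarrow> 'a \<Rightarrow> bool" where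
  "path_between V E u p v \<longleftrightarrow>
     p \<noteq> [] \<and> hd p = u \<and> last p = v \<and> distinct p \<and> set p \<subseteq> V \<and> set (path_edges p) \<subseteq> E"

definition connected_graph :: "'a set \<Rightarrow> 'a set set \<Rightarrow> bool" where
  "connected_graph V E \<longleftrightarrow> V \<noteq> {} \<and> (\<forall>u\<in>V. \<forall>v\<in>V. \<exists>p. path_between V E u p v)"

text \<open>A total-coloring is a function on the disjoint sum of vertices (\<open>Inl\<close>) and edges (\<open>Inr\<close>);
  it need not be proper, and its values outside the graph are irrelevant. As graphs are finite,
  taking natural numbers as colors is no restriction.\<close>

type_synonym 'a total_coloring = "'a + 'a set \<Rightarrow> nat"

definition colors_used :: "'a set \<Rightarrow> 'a set set \<Rightarrow> 'a total_coloring \<Rightarrow> nat set" where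
  "colors_used V E c = c ` (Inl ` V \<union> Inr ` E)"

definition total_rainbow :: "'a total_coloring \<Rightarrow> 'a list \<Rightarrow> bool" where
  "total_rainbow c p \<longleftrightarrow>
     distinct (map c (map Inr (path_edges p) @ map Inl (internal_vertices p)))"

definition total_rainbow_connected :: "'a set \<Rightarrow> 'a set set \<Rightarrow> 'a total_coloring \<Rightarrow> bool" where
  "total_rainbow_connected V E c \<longleftrightarrow>
     (\<forall>u\<in>V. \<forall>v\<in>V. u \<noteq> v \<longrightarrow> (\<exists>p. path_between V E u p v \<and> total_rainbow c p))"

definition trc :: "'a set \<Rightarrow> 'a set set \<Rightarrow> nat" where
  "trc V E = (LEAST k. \<exists>c. total_rainbow_connected V E c \<and> card (colors_used V E c) = k)"

end

theory Submission
  imports Defs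
begin

text \<open>
  The bound is proved for total-colorings in which, in addition, no vertex has the color of an
  incident edge; this extra property makes paths of length two extendable. Let \<open>v\<close> be a vertex
  whose deletion keeps both graphs connected; it exists for order at least five, because a cut
  vertex of one graph makes the rest of the other one a join. One of the graphs, say \<open>F\<close>, has all
  vertices within distance two of \<open>v\<close>. Let \<open>d\<close> be the number of non-neighbors of \<open>v\<close> in \<open>F\<close>. A
  coloring of \<open>F - v\<close> with \<open>k > d\<close> colors extends to \<open>F\<close> without a new color, provided that the
  non-neighbors are not all reached through the same neighbor of \<open>v\<close>, and a coloring of \<open>E - v\<close>
  extends to \<open>E\<close> with two new colors, so the sum grows by at most two. If \<open>F - v\<close> needs at most
  \<open>d\<close> colors, then \<open>d + 1\<close> colors suffice for \<open>F\<close>, and \<open>E\<close>, having a vertex of degree \<open>d\<close>, needs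
  at most \<open>2 n - 1 - d\<close> colors. If the non-neighbors are all reached through the same vertex, then
  any one of them can be deleted instead of \<open>v\<close>, with the roles of \<open>E\<close> and \<open>F\<close> exchanged. The
  induction starts at order six; there only the extensions of the fork, the unique exceptional
  graph of order five, need explicit colorings. The bounds are attained by paths and, for order
  five, by the fork.
\<close>

subsection \<open>Paths\<close>

definition path_items :: "'a list \<Rightarrow> ('a + 'a set) set" where
  "path_items p = Inr ` set (path_edges p) \<union> Inl ` set (internal_vertices p)"

lemma path_edges_Cons: "q \<noteq> [] \<Longrightarrow> path_edges (x # q) = {x, hd q} # path_edges q"
  by (cases q) auto

lemma path_edges_snoc: "p \<noteq> [] \<Longrightarrow> path_edges (p @ [x]) = path_edges p @ [{last p, x}]"
  by (induction p rule: path_edges.induct) auto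

lemma path_edges_rev: "path_edges (rev p) = rev (path_edges p)"
proof (induction p)
  case (Cons x p)
  then show ?case
    by (cases "p = []") (simp_all add: path_edges_snoc path_edges_Cons last_rev insert_commute)
qed simp

lemma path_edges_map: "path_edges (map f p) = map ((`) f) (path_edges p)"
  by (induction p rule: path_edges.induct) auto

lemma length_path_edges: "length (path_edges p) = length p - 1"
  by (induction p rule: path_edges.induct) auto

lemma path_edges_subset: "e \<in> set (path_edges p) \<Longrightarrow> e \<subseteq> set p"
  by (induction p rule: path_edges.induct) auto

lemma set_path_edges_prefix: "set (path_edges (p @ [y])) \<subseteq> set (path_edges (p @ y # q))"
  by (induction p rule: path_edges.induct) (auto simp: neq_Nil_conv split: list.splits)

lemma internal_vertices_rev: "internal_vertices (rev p) = rev (internal_vertices p)"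
proof (cases p rule: rev_cases)
  case (snoc q x)
  then show ?thesis by (cases q) (simp_all add: internal_vertices_def butlast_append butlast_rev)
qed (simp add: internal_vertices_def)

lemma internal_vertices_map: "internal_vertices (map f p) = map f (internal_vertices p)"
  by (simp add: internal_vertices_def map_tl map_butlast)

lemma internal_vertices_Cons:
  assumes "path_between V E w q u" "w \<noteq> u"
  shows "internal_vertices (x # q) = w # internal_vertices q"
proof -
  obtain z r where "q = w # z # r"
    using assms by (cases q; cases "tl q") (auto simp: path_between_def)
  then show ?thesis by (simp add: internal_vertices_def)
qed

lemma internal_vertices_subset: "set (internal_vertices p) \<subseteq> set p"
  unfolding internal_vertices_def by (cases p) (auto dest: in_set_butlastD)

lemma set_internal_vertices:
  assumes "path_between V E u p v"
  shows "set (internal_vertices p) = set p - {u, v}"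
proof (cases "u = v")
  case True
  then have "p = [u]" using assms by (cases p) (auto simp: path_between_def split: if_splits)
  then show ?thesis by (simp add: internal_vertices_def)
next
  case False
  then obtain q where "p = u # q @ [v]"
    using assms by (cases p; cases "tl p" rule: rev_cases) (auto simp: path_between_def)
  then show ?thesis using assms by (auto simp: internal_vertices_def path_between_def)
qed

lemma path_items_subset:
  assumes "path_between V E u p v"
  shows "path_items p \<subseteq> Inl ` V \<union> Inr ` E"
  using assms internal_vertices_subset[of p] by (auto simp: path_items_def path_between_def)

lemma path_between_rev: "path_between V E u p v \<Longrightarrow> path_between V E v (rev p) u"
  by (auto simp: path_between_def path_edges_rev hd_rev last_rev)

lemma path_between_mono:
  "path_between S E' u p v \<Longrightarrow> S \<subseteq> V \<Longrightarrow> E' \<subseteq> E \<Longrightarrow> path_between V E u p v"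
  by (auto simp: path_between_def)

lemma path_between_map:
  assumes "path_between V E u p v" "inj_on f V"
  shows "path_between (f ` V) ((`) f ` E) (f u) (map f p) (f v)"
  using assms
  by (auto simp: path_between_def path_edges_map hd_map last_map distinct_map inj_on_subset)

lemma path_between_edge:
  "{u, v} \<in> E \<Longrightarrow> u \<noteq> v \<Longrightarrow> u \<in> V \<Longrightarrow> v \<in> V \<Longrightarrow> path_between V E u [u, v] v"
  by (simp add: path_between_def)

lemma path_between_Cons:
  assumes "path_between V E w q u" "x \<notin> V" "{x, w} \<in> E"
  shows "path_between (insert x V) E x (x # q) u"
  using assms by (auto simp: path_between_def path_edges_Cons)

lemma path_between_extend:
  assumes path: "path_between V E u p x" and edge: "{x, y} \<in> E" "y \<in> V"
  shows "\<exists>q. path_between V E u q y"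
proof (cases "y \<in> set p")
  case True
  then obtain p1 p2 where "p = p1 @ y # p2" by (meson split_list)
  then have "path_between V E u (p1 @ [y]) y"
    using path set_path_edges_prefix[of p1 y p2] by (cases p1) (auto simp: path_between_def)
  then show ?thesis by blast
next
  case False
  then have "path_between V E u (p @ [y]) y"
    using path edge by (auto simp: path_between_def path_edges_snoc)
  then show ?thesis by blast
qed

lemma path_between_crosses:
  assumes path: "path_between V E u p v" and "u \<in> S" "v \<notin> S"
  obtains x y where "x \<in> S" "y \<in> V - S" "{x, y} \<in> set (path_edges p)" "{x, y} \<in> E"
proof -
  have "\<exists>x y. x \<in> S \<and> y \<notin> S \<and> {x, y} \<in> set (path_edges p)"
    if "p \<noteq> []" "hd p \<in> S" "last p \<notin> S"
    using that by (induction p rule: path_edges.induct) auto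
  then obtain x y where "x \<in> S" "y \<notin> S" "{x, y} \<in> set (path_edges p)"
    using assms by (auto simp: path_between_def)
  moreover from this have "y \<in> V" "{x, y} \<in> E"
    using path path_edges_subset[of "{x, y}" p] by (auto simp: path_between_def)
  ultimately show ?thesis using that by blast
qed

lemma path_length_ge_3:
  assumes "path_between V E u p v" "u \<noteq> v" "{u, v} \<notin> E"
  shows "3 \<le> length p"
proof -
  obtain w q where "p = u # w # q"
    using assms(1,2) by (cases p; cases "tl p") (auto simp: path_between_def)
  then show ?thesis using assms by (cases q) (auto simp: path_between_def)
qed

lemma path_length_ge_4:
  assumes "path_between V E u p v" "u \<noteq> v" "{u, v} \<notin> E" "\<And>x. {u, x} \<in> E \<Longrightarrow> {x, v} \<notin> E"
  shows "4 \<le> length p"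
proof (rule ccontr)
  assume "\<not> 4 \<le> length p"
  then have "length p = 3" using path_length_ge_3[OF assms(1-3)] by simp
  then obtain w where "p = [u, w, v]"
    using assms(1) by (auto simp: path_between_def length_Suc_conv numeral_eq_Suc)
  then show False using assms by (auto simp: path_between_def)
qed

subsection \<open>Connectivity\<close>

definition neighbors :: "'a set \<Rightarrow> 'a set set \<Rightarrow> 'a \<Rightarrow> 'a set" where
  "neighbors V E v = {x \<in> V - {v}. {v, x} \<in> E}"

lemma connected_graph_cut:
  assumes "connected_graph V E" "S \<inter> V \<noteq> {}" "\<not> V \<subseteq> S"
  obtains x y where "x \<in> S \<inter> V" "y \<in> V - S" "{x, y} \<in> E"
proof -
  obtain u v where separated: "u \<in> S \<inter> V" "v \<in> V" "v \<notin> S \<inter> V" using assms(2,3) by blast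
  then obtain p where "path_between V E u p v" using assms(1) by (auto simp: connected_graph_def)
  from path_between_crosses[OF this separated(1,3)] show ?thesis using that by blast
qed

lemma connected_graph_cutI:
  assumes "V \<noteq> {}"
    and crossing: "\<And>S. S \<subset> V \<Longrightarrow> S \<noteq> {} \<Longrightarrow> \<exists>x\<in>S. \<exists>y\<in>V - S. {x, y} \<in> E"
  shows "connected_graph V E"
proof -
  have "\<exists>p. path_between V E u p v" if vertices: "u \<in> V" "v \<in> V" for u v
  proof -
    define S where "S = {w \<in> V. \<exists>p. path_between V E u p w}"
    have "path_between V E u [u] u" using vertices by (simp add: path_between_def)
    then have "u \<in> S" using vertices by (auto simp: S_def)
    moreover have "y \<in> S" if "x \<in> S" "{x, y} \<in> E" "y \<in> V" for x y
      using that path_between_extend[OF _ that(2,3)] unfolding S_def by blast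
    moreover have "S \<subseteq> V" by (simp add: S_def)
    ultimately have "S = V" using crossing[of S] by blast
    then show ?thesis using vertices(2) unfolding S_def by blast
  qed
  then show ?thesis using assms(1) by (simp add: connected_graph_def)
qed

lemma connected_graph_singleton: "connected_graph {x} E"
  by (rule connected_graph_cutI) auto

lemma connected_graph_dominating:
  assumes dominator: "connected_graph S E" "S \<subseteq> V"
    and dominating: "\<And>x. x \<in> V - S \<Longrightarrow> \<exists>s\<in>S. {s, x} \<in> E"
  shows "connected_graph V E"
proof (rule connected_graph_cutI)
  show "V \<noteq> {}" using dominator by (auto simp: connected_graph_def)
  fix T assume proper_part: "T \<subset> V" "T \<noteq> {}"
  consider "T \<inter> S = {}" | "S \<subseteq> T" | "T \<inter> S \<noteq> {}" "\<not> S \<subseteq> T" by blast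
  then show "\<exists>x\<in>T. \<exists>y\<in>V - T. {x, y} \<in> E"
  proof cases
    assume "T \<inter> S = {}"
    obtain t where "t \<in> T" using proper_part by blast
    moreover from this obtain s where "s \<in> S" "{s, t} \<in> E"
      using dominating[of t] proper_part \<open>T \<inter> S = {}\<close> by blast
    ultimately show ?thesis
      using dominator(2) \<open>T \<inter> S = {}\<close>
      by (intro bexI[of _ t] bexI[of _ s]) (auto simp: insert_commute)
  next
    assume "S \<subseteq> T"
    obtain y where "y \<in> V - T" using proper_part by blast
    then show ?thesis using dominating[of y] \<open>S \<subseteq> T\<close> by blast
  next
    assume "T \<inter> S \<noteq> {}" "\<not> S \<subseteq> T"
    then obtain x y where "x \<in> T \<inter> S" "y \<in> S - T" "{x, y} \<in> E"
      using connected_graph_cut[OF dominator(1)] by metis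
    then show ?thesis using dominator(2) by blast
  qed
qed

lemma connected_graph_insert:
  "connected_graph S E \<Longrightarrow> s \<in> S \<Longrightarrow> {s, x} \<in> E \<Longrightarrow> connected_graph (insert x S) E"
  by (rule connected_graph_dominating) auto

lemma connected_graph_join:
  assumes "A \<noteq> {}" "B \<noteq> {}" "\<And>a b. a \<in> A \<Longrightarrow> b \<in> B \<Longrightarrow> {a, b} \<in> E"
  shows "connected_graph (A \<union> B) E"
proof -
  obtain a b where picked: "a \<in> A" "b \<in> B" using assms(1,2) by blast
  have "connected_graph {b, a} E"
    by (rule connected_graph_insert[OF connected_graph_singleton singletonI assms(3)[OF picked]])
  then show ?thesis
  proof (rule connected_graph_dominating)
    fix x assume "x \<in> A \<union> B - {b, a}"
    then show "\<exists>s\<in>{b, a}. {s, x} \<in> E"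
      using picked assms(3)[of a x] assms(3)[of x b] by (auto simp: insert_commute)
  qed (use picked in blast)
qed

lemma exists_connected_subset_of_card:
  assumes "finite V" "connected_graph V E" "1 \<le> k" "k \<le> card V"
  shows "\<exists>S\<subseteq>V. card S = k \<and> connected_graph S E"
  using assms(3,4)
proof (induction k rule: dec_induct)
  case base
  obtain x where "x \<in> V" using assms(2) by (auto simp: connected_graph_def)
  then show ?case using connected_graph_singleton[of x E] by (intro exI[of _ "{x}"]) simp
next
  case (step k)
  then obtain S where connected_part: "S \<subseteq> V" "card S = k" "connected_graph S E" by auto
  then have "S \<noteq> V" "S \<noteq> {}" using step by (auto simp: connected_graph_def)
  then obtain x y where crossing: "x \<in> S" "y \<in> V - S" "{x, y} \<in> E"
    using connected_graph_cut[OF assms(2), of S] connected_part(1)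
    by (metis IntD1 inf.absorb1 subset_antisym)
  have "finite S" using assms(1) connected_part(1) by (rule rev_finite_subset)
  then have "card (insert y S) = Suc k" using connected_part(2) crossing(2) by simp
  then show ?case
    using connected_graph_insert[OF connected_part(3) crossing(1,3)] connected_part(1) crossing(2)
    by (intro exI[of _ "insert y S"]) simp
qed

lemma exists_noncut_vertex:
  assumes "finite V" "connected_graph V E" "2 \<le> card V"
  shows "\<exists>v\<in>V. connected_graph (V - {v}) E"
proof -
  have "1 \<le> card V - 1" "card V - 1 \<le> card V" using assms(3) by simp_all
  from exists_connected_subset_of_card[OF assms(1,2) this]
  obtain S where connected_part: "S \<subseteq> V" "card S = card V - 1" "connected_graph S E" by blast
  have "finite S" using connected_part(1) assms(1) by (rule finite_subset)
  then have "card (V - S) = 1" using connected_part(1,2) assms(3) by (simp add: card_Diff_subset)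
  then obtain v where "V - S = {v}" by (rule card_1_singletonE)
  then have "v \<in> V" "V - {v} = S" using connected_part(1) by blast+
  then show ?thesis using connected_part(3) by auto
qed

lemma neighbors_nonempty:
  assumes "connected_graph V E" "v \<in> V" "2 \<le> card V"
  shows "neighbors V E v \<noteq> {}"
proof -
  have "\<not> V \<subseteq> {v}" using assms(3) card_mono[of "{v}" V] by auto
  then show ?thesis
    using connected_graph_cut[OF assms(1), of "{v}"] assms(2) by (auto simp: neighbors_def)
qed

lemma exists_degree_ge_2:
  assumes "finite V" "connected_graph V E" "3 \<le> card V"
  shows "\<exists>w\<in>V. 2 \<le> card (neighbors V E w)"
proof -
  obtain u where u_in: "u \<in> V" using assms(2) by (auto simp: connected_graph_def)
  then have "neighbors V E u \<noteq> {}" using neighbors_nonempty[OF assms(2)] assms(3) by simp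
  then obtain w where w_neighbor: "w \<in> neighbors V E u" by blast
  have edge: "w \<in> V" "w \<noteq> u" "{u, w} \<in> E" using w_neighbor by (simp_all add: neighbors_def)
  have "\<not> V \<subseteq> {u, w}" using assms(3) edge(2) card_mono[of "{u, w}" V] by auto
  moreover have "{u, w} \<inter> V \<noteq> {}" using u_in by simp
  ultimately obtain x y where crossing: "x \<in> {u, w} \<inter> V" "y \<in> V - {u, w}" "{x, y} \<in> E"
    by (metis assms(2) connected_graph_cut)
  define z where "z = (if x = u then w else u)"
  have other_neighbor: "z \<in> V" "z \<noteq> x" "z \<noteq> y" "{x, z} \<in> E"
    using crossing(1,2) u_in edge by (auto simp: z_def insert_commute)
  have "{z, y} \<subseteq> neighbors V E x" using other_neighbor crossing by (auto simp: neighbors_def)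
  moreover have "finite (neighbors V E x)" using assms(1) by (simp add: neighbors_def)
  ultimately have "card {z, y} \<le> card (neighbors V E x)" by (simp add: card_mono)
  then have "2 \<le> card (neighbors V E x)" using other_neighbor(3) by simp
  then show ?thesis using crossing(1) by blast
qed

subsection \<open>Rainbow paths\<close>

lemma total_rainbow_iff_inj_on:
  "total_rainbow c p \<longleftrightarrow>
    distinct (path_edges p) \<and> distinct (internal_vertices p) \<and> inj_on c (path_items p)"
proof -
  have "distinct (map Inr (path_edges p) @ map Inl (internal_vertices p)) \<longleftrightarrow>
      distinct (path_edges p) \<and> distinct (internal_vertices p)"
    by (auto simp: distinct_map)
  then show ?thesis
    unfolding total_rainbow_def path_items_def
    by (simp only: distinct_map set_append set_map) blast
qed

lemma total_rainbow_cong: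
  "(\<And>z. z \<in> path_items p \<Longrightarrow> c' z = c z) \<Longrightarrow> total_rainbow c' p \<longleftrightarrow> total_rainbow c p"
  unfolding total_rainbow_iff_inj_on by (metis inj_on_cong)

lemma total_rainbow_upd_fresh:
  "total_rainbow c p \<Longrightarrow> (\<And>y. c y \<noteq> a) \<Longrightarrow> total_rainbow (c(z := a)) p"
  unfolding total_rainbow_iff_inj_on by (auto intro!: inj_on_fun_updI)

lemma total_rainbow_rev: "total_rainbow c (rev p) \<longleftrightarrow> total_rainbow c p"
  by (simp add: total_rainbow_iff_inj_on path_items_def path_edges_rev internal_vertices_rev)

lemma total_rainbow_edge: "total_rainbow c [u, v]"
  by (simp add: total_rainbow_def internal_vertices_def)

lemma total_rainbow_two_edges:
  "total_rainbow c [u, w, v] \<longleftrightarrow> distinct [c (Inr {u, w}), c (Inl w), c (Inr {w, v})]"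
  by (auto simp: total_rainbow_def internal_vertices_def)

lemma total_rainbow_Cons:
  assumes path: "path_between V E w q u" "w \<noteq> u"
  shows "total_rainbow c (x # q) \<longleftrightarrow> total_rainbow c q \<and> c (Inr {x, w}) \<noteq> c (Inl w) \<and>
    c (Inr {x, w}) \<notin> c ` path_items q \<and> c (Inl w) \<notin> c ` path_items q"
  using internal_vertices_Cons[OF path, of x] path(1)
  by (auto simp: total_rainbow_def path_items_def path_between_def path_edges_Cons image_Un
      image_image)

lemma total_rainbow_connected_symI:
  assumes "\<And>u v. u \<in> V \<Longrightarrow> v \<in> V \<Longrightarrow> u \<noteq> v \<Longrightarrow>
    \<exists>p. (path_between V E u p v \<or> path_between V E v p u) \<and> total_rainbow c p"
  shows "total_rainbow_connected V E c"
  unfolding total_rainbow_connected_def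
  by (meson assms path_between_rev total_rainbow_rev)

subsection \<open>Colorable graphs\<close>

definition incidence_proper :: "'a set \<Rightarrow> 'a set set \<Rightarrow> 'a total_coloring \<Rightarrow> bool" where
  "incidence_proper V E c \<longleftrightarrow> (\<forall>x\<in>V. \<forall>y\<in>neighbors V E x. c (Inl x) \<noteq> c (Inr {x, y}))"

definition rainbow_colorable :: "'a set \<Rightarrow> 'a set set \<Rightarrow> nat \<Rightarrow> bool" where
  "rainbow_colorable V E k \<longleftrightarrow>
     (\<exists>c. total_rainbow_connected V E c \<and> incidence_proper V E c \<and> (\<forall>z. c z < k))"

lemma incidence_properD:
  "incidence_proper V E c \<Longrightarrow> x \<in> V \<Longrightarrow> y \<in> V \<Longrightarrow> x \<noteq> y \<Longrightarrow> {x, y} \<in> E \<Longrightarrow>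
    c (Inl x) \<noteq> c (Inr {x, y})"
  by (simp add: incidence_proper_def neighbors_def)

lemma rainbow_colorable_le: "rainbow_colorable V E k \<Longrightarrow> k \<le> l \<Longrightarrow> rainbow_colorable V E l"
  unfolding rainbow_colorable_def by (meson order_less_le_trans)

lemma exists_color_avoiding:
  fixes A :: "nat set"
  assumes "finite A" "card A < k"
  shows "\<exists>a<k. a \<notin> A"
proof -
  have "\<not> {..<k} \<subseteq> A" using assms card_mono[of A "{..<k}"] by auto
  then show ?thesis by auto
qed

lemma rainbow_colorable_supergraph:
  assumes "rainbow_colorable V E' k" "E' \<subseteq> E" "3 \<le> k"
  shows "rainbow_colorable V E k"
proof -
  obtain c where coloring: "total_rainbow_connected V E' c" "incidence_proper V E' c" "\<And>z. c z < k"
    using assms(1) unfolding rainbow_colorable_def by blast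
  have "\<exists>a<k. \<forall>x y. e = {x, y} \<longrightarrow> a \<noteq> c (Inl x)" for e
  proof (cases "\<exists>x y. e = {x, y}")
    case True
    then obtain x y where doubleton: "e = {x, y}" by blast
    have "card {c (Inl x), c (Inl y)} < k" using assms(3) by (simp add: card_insert_if)
    then obtain a where "a < k" "a \<notin> {c (Inl x), c (Inl y)}"
      using exists_color_avoiding[of "{c (Inl x), c (Inl y)}" k] by blast
    then show ?thesis using doubleton by (intro exI[of _ a]) (auto simp: doubleton_eq_iff)
  qed (use assms(3) in \<open>auto intro!: exI[of _ 0]\<close>)
  then obtain h where new_color: "\<And>e. h e < k" "\<And>x y. h {x, y} \<noteq> c (Inl x)" by metis
  define c' where "c' z = (case z of Inr e \<Rightarrow> if e \<in> E' then c z else h e | _ \<Rightarrow> c z)" for z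
  have "\<exists>p. path_between V E u p v \<and> total_rainbow c' p"
    if endpoints: "u \<in> V" "v \<in> V" "u \<noteq> v" for u v
  proof -
    obtain p where path: "path_between V E' u p v" "total_rainbow c p"
      using coloring(1) endpoints unfolding total_rainbow_connected_def by blast
    have "c' z = c z" if "z \<in> path_items p" for z
      using that path_items_subset[OF path(1)] by (auto simp: c'_def)
    then show ?thesis
      using path(2) path_between_mono[OF path(1) subset_refl assms(2)] total_rainbow_cong by metis
  qed
  moreover have "incidence_proper V E c'"
    using coloring(2) new_color(2)[THEN not_sym]
    by (simp add: incidence_proper_def neighbors_def c'_def)
  moreover have "c' z < k" for z
    using coloring(3) new_color(1) by (simp add: c'_def split: sum.split)
  ultimately show ?thesis
    unfolding rainbow_colorable_def total_rainbow_connected_def by blast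
qed

lemma incidence_proper_image:
  assumes "incidence_proper V E c" "inj_on f V" "\<And>e. e \<in> E \<Longrightarrow> e \<subseteq> V"
    and "\<And>x. x \<in> V \<Longrightarrow> c' (Inl (f x)) = c (Inl x)"
    and "\<And>e. e \<subseteq> V \<Longrightarrow> c' (Inr (f ` e)) = c (Inr e)"
  shows "incidence_proper (f ` V) ((`) f ` E) c'"
  unfolding incidence_proper_def neighbors_def
proof (intro ballI, elim CollectE conjE DiffE imageE)
  fix a b x y e
  assume image: "a = f x" "b = f y" "x \<in> V" "y \<in> V" "b \<notin> {a}"
    and image_edge: "{a, b} = f ` e" "e \<in> E"
  have "e = {x, y}"
    using image image_edge assms(3) inj_on_image_eq_iff[OF assms(2), of e "{x, y}"] by simp
  then show "c' (Inl a) \<noteq> c' (Inr {a, b})"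
    using image image_edge assms(4)[of x] assms(5)[of "{x, y}"]
      incidence_properD[OF assms(1), of x y] by auto
qed

lemma rainbow_colorable_image:
  assumes "rainbow_colorable V E k" and inj: "inj_on f V" and sub: "\<And>e. e \<in> E \<Longrightarrow> e \<subseteq> V"
  shows "rainbow_colorable (f ` V) ((`) f ` E) k"
proof -
  obtain c where coloring: "total_rainbow_connected V E c" "incidence_proper V E c" "\<And>z. c z < k"
    using assms(1) unfolding rainbow_colorable_def by blast
  define c' where "c' = c \<circ> map_sum (inv_into V f) ((`) (inv_into V f))"
  have c'_vertex: "c' (Inl (f x)) = c (Inl x)" if "x \<in> V" for x
    using inj that by (simp add: c'_def)
  have c'_edge: "c' (Inr (f ` e)) = c (Inr e)" if "e \<subseteq> V" for e
    using inj that by (simp add: c'_def)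
  have "\<exists>q. path_between (f ` V) ((`) f ` E) (f u) q (f v) \<and> total_rainbow c' q"
    if endpoints: "u \<in> V" "v \<in> V" "u \<noteq> v" for u v
  proof -
    obtain p where path: "path_between V E u p v" "total_rainbow c p"
      using coloring(1) endpoints unfolding total_rainbow_connected_def by blast
    have vertices_in: "x \<in> V" if "x \<in> set (internal_vertices p)" for x
      using that path(1) by (auto simp: set_internal_vertices path_between_def)
    have edges_in: "e \<subseteq> V" if "e \<in> set (path_edges p)" for e
      using that path(1) path_edges_subset by (fastforce simp: path_between_def)
    have "map c' (map Inr (path_edges (map f p)) @ map Inl (internal_vertices (map f p))) =
        map c (map Inr (path_edges p) @ map Inl (internal_vertices p))"
      using vertices_in edges_in c'_vertex c'_edge
      by (simp add: path_edges_map internal_vertices_map)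
    then have "total_rainbow c' (map f p)" using path(2) unfolding total_rainbow_def by metis
    then show ?thesis using path_between_map[OF path(1) inj] by blast
  qed
  then have "total_rainbow_connected (f ` V) ((`) f ` E) c'"
    unfolding total_rainbow_connected_def by fast
  moreover have "incidence_proper (f ` V) ((`) f ` E) c'"
    using coloring(2) inj sub c'_vertex c'_edge by (rule incidence_proper_image)
  moreover have "c' z < k" for z using coloring(3) by (simp add: c'_def)
  ultimately show ?thesis unfolding rainbow_colorable_def by blast
qed

lemma rainbow_colorable_embed:
  assumes colorable: "rainbow_colorable {..<n} E\<^sub>0 k" and sub: "\<And>e. e \<in> E\<^sub>0 \<Longrightarrow> e \<subseteq> {..<n}"
    and embedding: "length vs = n" "distinct vs" "(`) ((!) vs) ` E\<^sub>0 \<subseteq> E" and colors_ge: "3 \<le> k"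
  shows "rainbow_colorable (set vs) E k"
proof -
  have "inj_on ((!) vs) {..<n}" using embedding(1,2) by (simp add: inj_on_nth)
  moreover have "(!) vs ` {..<n} = set vs" using embedding(1) by (auto simp: set_conv_nth)
  ultimately have "rainbow_colorable (set vs) ((`) ((!) vs) ` E\<^sub>0) k"
    using rainbow_colorable_image[OF colorable _ sub, of "(!) vs"] by simp
  then show ?thesis using embedding(3) colors_ge by (rule rainbow_colorable_supergraph)
qed

subsection \<open>Extending a coloring by one vertex\<close>

definition extend_coloring ::
    "'a total_coloring \<Rightarrow> 'a \<Rightarrow> nat \<Rightarrow> ('a \<Rightarrow> nat) \<Rightarrow> 'a total_coloring" where
  "extend_coloring c v a s z = (case z of
      Inl x \<Rightarrow> if x = v then a else c z
    | Inr e \<Rightarrow> if v \<in> e then s (the_elem (e - {v})) else c z)"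

lemma extend_coloring_simps [simp]:
  "extend_coloring c v a s (Inl v) = a"
  "x \<noteq> v \<Longrightarrow> extend_coloring c v a s (Inl x) = c (Inl x)"
  "v \<notin> e \<Longrightarrow> extend_coloring c v a s (Inr e) = c (Inr e)"
  "y \<noteq> v \<Longrightarrow> extend_coloring c v a s (Inr {v, y}) = s y"
  "y \<noteq> v \<Longrightarrow> extend_coloring c v a s (Inr {y, v}) = s y"
  by (simp_all add: extend_coloring_def insert_Diff_if)

lemma extend_coloring_path_items:
  assumes "path_between S E u p w" "v \<notin> S" "z \<in> path_items p"
  shows "extend_coloring c v a s z = c z"
proof -
  have path_in: "set p \<subseteq> S" using assms(1) by (simp add: path_between_def)
  from assms(3) show ?thesis
    unfolding path_items_def
  proof (elim UnE imageE)
    fix e assume "z = Inr e" "e \<in> set (path_edges p)"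
    moreover from this have "v \<notin> e" using path_in assms(2) path_edges_subset[of e p] by blast
    ultimately show ?thesis by simp
  next
    fix x assume "z = Inl x" "x \<in> set (internal_vertices p)"
    moreover from this have "x \<noteq> v" using path_in assms(2) internal_vertices_subset[of p] by blast
    ultimately show ?thesis by simp
  qed
qed

lemma incidence_proper_extend_coloring:
  assumes "incidence_proper S E c" "v \<notin> S" "\<And>y. y \<in> S \<Longrightarrow> s y \<noteq> a \<and> s y \<noteq> c (Inl y)"
  shows "incidence_proper (insert v S) E (extend_coloring c v a s)" (is "incidence_proper _ _ ?c")
  unfolding incidence_proper_def neighbors_def
proof (intro ballI, elim CollectE conjE DiffE)
  fix x y assume edge: "x \<in> insert v S" "y \<in> insert v S" "y \<notin> {x}" "{x, y} \<in> E"
  then consider (old) "x \<in> S" "y \<in> S" | (new_first) "x = v" "y \<in> S" | (new_second) "y = v" "x \<in> S"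
    by blast
  then show "?c (Inl x) \<noteq> ?c (Inr {x, y})"
  proof cases
    case old
    then have "x \<noteq> v" "v \<notin> {x, y}" using assms(2) by auto
    then show ?thesis using old edge(3,4) incidence_properD[OF assms(1), of x y] by simp
  next
    case new_first
    then show ?thesis using assms(2) assms(3)[of y] by (cases "y = v") auto
  next
    case new_second
    then show ?thesis using assms(2) assms(3)[of x] by (cases "x = v") auto
  qed
qed

lemma rainbow_colorable_insertI:
  assumes coloring: "total_rainbow_connected S E c" "incidence_proper S E c" "\<And>z. c z < k"
    and "v \<notin> S" "a < k" "\<And>y. s y < k" "\<And>y. y \<in> S \<Longrightarrow> s y \<noteq> a \<and> s y \<noteq> c (Inl y)"
    and new: "\<And>x. x \<in> S \<Longrightarrow>
      \<exists>p. path_between (insert v S) E v p x \<and> total_rainbow (extend_coloring c v a s) p"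
  shows "rainbow_colorable (insert v S) E k"
proof -
  let ?c = "extend_coloring c v a s"
  have "total_rainbow_connected (insert v S) E ?c"
  proof (rule total_rainbow_connected_symI)
    fix u w assume endpoints: "u \<in> insert v S" "w \<in> insert v S" "u \<noteq> w"
    show "\<exists>p. (path_between (insert v S) E u p w \<or> path_between (insert v S) E w p u) \<and>
        total_rainbow ?c p"
    proof (cases "u = v \<or> w = v")
      case True
      then show ?thesis using new endpoints by blast
    next
      case False
      then obtain p where path: "path_between S E u p w" "total_rainbow c p"
        using coloring(1) endpoints unfolding total_rainbow_connected_def by blast
      then have "total_rainbow ?c p"
        using total_rainbow_cong extend_coloring_path_items[OF path(1) assms(4)] by metis
      then show ?thesis using path_between_mono[OF path(1) subset_insertI subset_refl] by blast
    qed
  qed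
  moreover have "incidence_proper (insert v S) E ?c"
    using coloring(2) assms(4,7) by (rule incidence_proper_extend_coloring)
  moreover have "?c z < k" for z
    using coloring(3) assms(5,6) by (simp add: extend_coloring_def split: sum.split)
  ultimately show ?thesis unfolding rainbow_colorable_def by blast
qed

text \<open>Giving the neighbor \<open>w\<close> of the new vertex a fresh color keeps the old rainbow paths rainbow
  and makes those starting in \<open>w\<close> extendable.\<close>

lemma total_rainbow_extend_coloring_Cons:
  assumes path: "path_between S E w q u" "w \<noteq> u" "total_rainbow c q"
    and new: "w \<in> S" "x \<notin> S" and bound: "\<And>z. c z < k"
  shows "total_rainbow (extend_coloring (c(Inl w := k)) x 0 (\<lambda>_. k + 1)) (x # q)"
    (is "total_rainbow ?c (x # q)")
proof -
  have old: "?c z = c z" if "z \<in> path_items q" for z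
    using that extend_coloring_path_items[OF path(1) new(2) that] set_internal_vertices[OF path(1)]
    by (auto simp: path_items_def)
  then have "total_rainbow ?c q" using path(3) total_rainbow_cong by metis
  moreover have "?c ` path_items q \<subseteq> {..<k}" using old bound by auto
  moreover have "w \<noteq> x" using new by blast
  then have "?c (Inr {x, w}) = k + 1" "?c (Inl w) = k" by simp_all
  ultimately show ?thesis unfolding total_rainbow_Cons[OF path(1,2)] by auto
qed

lemma rainbow_colorable_insert_adjacent:
  assumes "rainbow_colorable S E k" and edge: "w \<in> S" "x \<notin> S" "{x, w} \<in> E"
  shows "rainbow_colorable (insert x S) E (k + 2)"
proof -
  obtain c where coloring: "total_rainbow_connected S E c" "incidence_proper S E c" "\<And>z. c z < k"
    using assms(1) unfolding rainbow_colorable_def by blast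
  let ?c = "c(Inl w := k)"
  let ?c' = "extend_coloring ?c x 0 (\<lambda>_. k + 1)"
  have fresh: "c z \<noteq> k" for z using coloring(3)[of z] by simp
  have rainbow_upd: "total_rainbow ?c p" if "total_rainbow c p" for p
    using that fresh by (rule total_rainbow_upd_fresh)
  show ?thesis
  proof (rule rainbow_colorable_insertI[OF _ _ _ edge(2)])
    show "total_rainbow_connected S E ?c"
      using coloring(1) rainbow_upd unfolding total_rainbow_connected_def by blast
    show "incidence_proper S E ?c"
      using coloring(2) fresh[THEN not_sym] by (simp add: incidence_proper_def)
    show "?c z < k + 2" for z using coloring(3)[of z] by simp
    show "k + 1 \<noteq> 0 \<and> k + 1 \<noteq> ?c (Inl y)" for y using coloring(3)[of "Inl y"] by simp
    show "\<exists>p. path_between (insert x S) E x p u \<and> total_rainbow ?c' p" if u_old: "u \<in> S" for u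
    proof (cases "w = u")
      case True
      have "path_between (insert x S) E x [x, w] w"
        by (rule path_between_edge) (use edge in auto)
      then show ?thesis unfolding True using total_rainbow_edge by (intro exI conjI)
    next
      case False
      then obtain q where path: "path_between S E w q u" "total_rainbow c q"
        using coloring(1) edge(1) u_old unfolding total_rainbow_connected_def by blast
      have "total_rainbow ?c' (x # q)"
        using path(1) False path(2) edge(1,2) coloring(3)
        by (rule total_rainbow_extend_coloring_Cons)
      then show ?thesis using path_between_Cons[OF path(1) edge(2,3)] by blast
    qed
  qed simp_all
qed

lemma rainbow_colorable_grow:
  assumes "finite V" "connected_graph V E" "rainbow_colorable S E k" "S \<subseteq> V" "S \<noteq> {}"
  shows "rainbow_colorable V E (k + 2 * card (V - S))"
  using assms(3-)
proof (induction "card (V - S)" arbitrary: S k)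
  case 0
  then show ?case using assms(1) by (simp add: subset_antisym)
next
  case (Suc n)
  then have "\<not> V \<subseteq> S" by (metis Diff_eq_empty_iff card.empty nat.distinct(1))
  moreover have "S \<inter> V \<noteq> {}" using Suc.prems by blast
  ultimately obtain w x where crossing: "w \<in> S \<inter> V" "x \<in> V - S" "{w, x} \<in> E"
    using connected_graph_cut[OF assms(2)] by metis
  then have colored: "rainbow_colorable (insert x S) E (k + 2)"
    using rainbow_colorable_insert_adjacent[OF Suc.prems(1), of w x] by (simp add: insert_commute)
  have "V - S - {x} = V - insert x S" by blast
  then have card: "n = card (V - insert x S)"
    using Suc.hyps(2) crossing(2) by (metis card_Diff_singleton diff_Suc_1)
  have "rainbow_colorable V E (k + 2 + 2 * card (V - insert x S))"
    by (rule Suc.hyps(1)[OF card colored]) (use Suc.prems(2) crossing(2) in auto)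
  then show ?case by (simp flip: Suc.hyps(2) card)
qed

lemma rainbow_colorable_star:
  assumes "finite X" "X \<noteq> {}" "w \<notin> X" and edges: "\<And>x. x \<in> X \<Longrightarrow> {w, x} \<in> E"
  shows "rainbow_colorable (insert w X) E (card X + 1)"
proof -
  obtain g where "bij_betw g ((\<lambda>x. {w, x}) ` X) {0..<card ((\<lambda>x. {w, x}) ` X)}"
    using ex_bij_betw_finite_nat assms(1) by blast
  moreover have "card ((\<lambda>x. {w, x}) ` X) = card X"
    by (rule card_image) (auto simp: inj_on_def doubleton_eq_iff)
  ultimately have numbering: "inj_on g ((\<lambda>x. {w, x}) ` X)" "\<And>x. x \<in> X \<Longrightarrow> g {w, x} < card X"
    by (fastforce simp: bij_betw_def)+
  define c :: "'a total_coloring" where "c z = (case z of Inl x \<Rightarrow> 0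
    | Inr e \<Rightarrow> if e \<in> (\<lambda>x. {w, x}) ` X then Suc (g e) else 1)" for z
  have c_edge: "c (Inr {w, x}) = Suc (g {w, x})" if "x \<in> X" for x using that by (simp add: c_def)
  have "total_rainbow_connected (insert w X) E c"
  proof (rule total_rainbow_connected_symI)
    fix u v assume endpoints: "u \<in> insert w X" "v \<in> insert w X" "u \<noteq> v"
    consider "{u, v} \<in> E" | "u \<in> X" "v \<in> X" using endpoints edges by (auto simp: insert_commute)
    then show "\<exists>p. (path_between (insert w X) E u p v \<or> path_between (insert w X) E v p u) \<and>
        total_rainbow c p"
    proof cases
      assume "{u, v} \<in> E"
      then have "path_between (insert w X) E u [u, v] v"
        using endpoints by (intro path_between_edge)
      then show ?thesis using total_rainbow_edge by (intro exI conjI disjI1)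
    next
      assume leaves: "u \<in> X" "v \<in> X"
      then have "path_between (insert w X) E u [u, w, v] v"
        using endpoints(3) assms(3) edges by (auto simp: path_between_def insert_commute)
      moreover have "g {w, u} \<noteq> g {w, v}"
        using numbering(1) leaves endpoints(3) by (auto simp: inj_on_def doubleton_eq_iff)
      then have "total_rainbow c [u, w, v]"
        using leaves c_edge
        by (simp add: total_rainbow_two_edges insert_commute[of u w "{}"] c_def[of "Inl w"])
      ultimately show ?thesis by blast
    qed
  qed
  moreover have "incidence_proper (insert w X) E c"
    by (simp add: incidence_proper_def c_def)
  moreover have "0 < card X" using assms(1,2) by (simp add: card_gt_0_iff)
  then have "c z < card X + 1" for z
    using numbering(2) by (auto simp: c_def split: sum.split)
  ultimately show ?thesis unfolding rainbow_colorable_def by blast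
qed

lemma rainbow_colorable_neighbors:
  assumes "finite V" "connected_graph V E" "w \<in> V" "X \<subseteq> neighbors V E w" "X \<noteq> {}"
  shows "rainbow_colorable V E (2 * card V - 1 - card X)"
proof -
  have star: "insert w X \<subseteq> V" "w \<notin> X" "\<And>x. x \<in> X \<Longrightarrow> {w, x} \<in> E" "finite X"
    using assms finite_subset[of X V] by (auto simp: neighbors_def)
  have "rainbow_colorable (insert w X) E (card X + 1)"
    using star(4) assms(5) star(2,3) by (rule rainbow_colorable_star)
  then have "rainbow_colorable V E (card X + 1 + 2 * card (V - insert w X))"
    using star(1) by (rule rainbow_colorable_grow[OF assms(1,2)]) simp
  moreover have "card X + 1 + 2 * card (V - insert w X) = 2 * card V - 1 - card X"
    using card_Diff_subset[OF _ star(1)] card_mono[OF assms(1) star(1)] star(2,4) by simp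
  ultimately show ?thesis by simp
qed

definition non_neighbors :: "'a set \<Rightarrow> 'a set set \<Rightarrow> 'a \<Rightarrow> 'a set" where
  "non_neighbors V E v = V - {v} - neighbors V E v"

definition relay :: "'a set \<Rightarrow> 'a set set \<Rightarrow> 'a \<Rightarrow> ('a \<Rightarrow> 'a) \<Rightarrow> bool" where
  "relay V E v m \<longleftrightarrow> (\<forall>x\<in>non_neighbors V E v. m x \<in> neighbors V E v \<and> {m x, x} \<in> E)"

definition spread_out :: "'a set \<Rightarrow> 'a set set \<Rightarrow> 'a \<Rightarrow> bool" where
  "spread_out V E v \<longleftrightarrow> (\<exists>m. relay V E v m \<and>
     (card (non_neighbors V E v) = 1 \<or>
       (\<exists>x\<in>non_neighbors V E v. \<exists>y\<in>non_neighbors V E v. m x \<noteq> m y)))"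

lemma exists_relay_colors:
  fixes f g :: "'a \<Rightarrow> nat"
  assumes served: "finite N" "card N < k" "\<And>y. card {x \<in> N. m x = y} + 2 \<le> k"
    and colors_ge: "3 \<le> k"
  obtains a s where "a < k" "\<And>y. s y < k" "\<And>y. s y \<noteq> a" "\<And>y. s y \<noteq> f y"
    "\<And>x. x \<in> N \<Longrightarrow> s (m x) \<noteq> g x"
proof -
  have "\<exists>b<k. b \<notin> insert (f y) (g ` {x \<in> N. m x = y})" for y
  proof (rule exists_color_avoiding)
    have "card (insert (f y) (g ` {x \<in> N. m x = y})) \<le> Suc (card (g ` {x \<in> N. m x = y}))"
      by (rule card_insert_le_m1) simp_all
    also have "\<dots> \<le> Suc (card {x \<in> N. m x = y})"
      using card_image_le[of "{x \<in> N. m x = y}" g] served(1) by simp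
    finally show "card (insert (f y) (g ` {x \<in> N. m x = y})) < k" using served(3)[of y] by simp
  qed (use served(1) in simp)
  then obtain t where relay_color: "\<And>y. t y < k" "\<And>y. t y \<notin> insert (f y) (g ` {x \<in> N. m x = y})"
    by metis
  have "card ((\<lambda>x. t (m x)) ` N) < k"
    using card_image_le[OF served(1)] served(2) by (rule le_less_trans)
  then obtain a where center_color: "a < k" "a \<notin> (\<lambda>x. t (m x)) ` N"
    using exists_color_avoiding[of "(\<lambda>x. t (m x)) ` N" k] served(1) by blast
  have "\<exists>b<k. b \<noteq> a \<and> b \<notin> insert (f y) (g ` {x \<in> N. m x = y})" for y
  proof (cases "y \<in> m ` N")
    case True
    then show ?thesis using relay_color center_color(2) by (intro exI[of _ "t y"]) auto
  next
    case False
    have "card {a, f y} < k" using colors_ge by (simp add: card_insert_if)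
    then obtain b where "b < k" "b \<notin> {a, f y}" using exists_color_avoiding[of "{a, f y}" k] by blast
    then show ?thesis using False by (intro exI[of _ b]) auto
  qed
  then obtain s where "\<And>y. s y < k" "\<And>y. s y \<noteq> a"
    "\<And>y. s y \<notin> insert (f y) (g ` {x \<in> N. m x = y})" by metis
  then show ?thesis using that[of a s] center_color(1) by blast
qed

lemma card_fibre_le:
  assumes "finite N" "card N < k" "3 \<le> k" "card N = 1 \<or> (\<exists>x\<in>N. \<exists>y\<in>N. m x \<noteq> m y)"
  shows "card {x \<in> N. m x = z} + 2 \<le> k"
  using assms(4)
proof
  assume "card N = 1"
  moreover have "card {x \<in> N. m x = z} \<le> card N" using assms(1) by (intro card_mono) auto
  ultimately show ?thesis using assms(3) by simp
next
  assume "\<exists>x\<in>N. \<exists>y\<in>N. m x \<noteq> m y"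
  then obtain x y where distinguished: "x \<in> N" "y \<in> N" "m x \<noteq> m y" by blast
  then have "x \<notin> {x \<in> N. m x = z} \<or> y \<notin> {x \<in> N. m x = z}" by auto
  then have "{x \<in> N. m x = z} \<subset> N" using distinguished(1,2) by blast
  then have "card {x \<in> N. m x = z} < card N" by (rule psubset_card_mono[OF assms(1)])
  then show ?thesis using assms(2) by simp
qed

text \<open>Relays shared by too many non-neighbors are the only obstruction to keeping the number of
  colors: the edge from \<open>v\<close> to a relay \<open>y\<close> has to avoid the colors of \<open>y\<close>, of \<open>v\<close>, and of all edges
  leading from \<open>y\<close> to the vertices it serves.\<close>

lemma rainbow_colorable_extend:
  assumes "finite V" "v \<in> V" "spread_out V E v" "rainbow_colorable (V - {v}) E k"
    and colors: "3 \<le> k" "card (non_neighbors V E v) < k"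
  shows "rainbow_colorable V E k"
proof -
  let ?N = "non_neighbors V E v"
  obtain m where relays: "\<And>x. x \<in> ?N \<Longrightarrow> m x \<in> neighbors V E v \<and> {m x, x} \<in> E"
    and spread: "card ?N = 1 \<or> (\<exists>x\<in>?N. \<exists>y\<in>?N. m x \<noteq> m y)"
    using assms(3) unfolding spread_out_def relay_def by blast
  obtain c where coloring: "total_rainbow_connected (V - {v}) E c" "incidence_proper (V - {v}) E c"
    "\<And>z. c z < k"
    using assms(4) unfolding rainbow_colorable_def by blast
  have finite_served: "finite ?N" using assms(1) by (simp add: non_neighbors_def)
  have fibre: "card {x \<in> ?N. m x = y} + 2 \<le> k" for y
    using finite_served colors(2,1) spread by (rule card_fibre_le)
  obtain a s where new_colors: "a < k" "\<And>y. s y < k" "\<And>y. s y \<noteq> a" "\<And>y. s y \<noteq> c (Inl y)"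
    "\<And>x. x \<in> ?N \<Longrightarrow> s (m x) \<noteq> c (Inr {m x, x})"
    by (rule exists_relay_colors[OF finite_served colors(2) fibre colors(1),
          where f = "\<lambda>y. c (Inl y)" and g = "\<lambda>x. c (Inr {m x, x})"]) metis
  let ?c = "extend_coloring c v a s"
  have "\<exists>p. path_between V E v p x \<and> total_rainbow ?c p" if x_old: "x \<in> V - {v}" for x
  proof (cases "x \<in> ?N")
    case False
    then have "path_between V E v [v, x] x"
      using x_old assms(2) by (intro path_between_edge) (auto simp: non_neighbors_def neighbors_def)
    then show ?thesis using total_rainbow_edge by (intro exI conjI)
  next
    case True
    note mx = relays[OF True]
    have neq: "m x \<noteq> x" "m x \<noteq> v" "x \<noteq> v" "m x \<in> V" "{v, m x} \<in> E"
      using True mx by (auto simp: non_neighbors_def neighbors_def)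
    have "path_between V E v [v, m x, x] x"
      using assms(2) x_old mx neq by (simp add: path_between_def)
    moreover have "c (Inl (m x)) \<noteq> c (Inr {m x, x})"
      using incidence_properD[OF coloring(2), of "m x" x] x_old mx neq by simp
    then have "total_rainbow ?c [v, m x, x]"
      using neq new_colors(4)[of "m x"] new_colors(5)[OF True]
      by (simp add: total_rainbow_two_edges)
    ultimately show ?thesis by blast
  qed
  then have "rainbow_colorable (insert v (V - {v})) E k"
    using assms(2) coloring new_colors
    by (intro rainbow_colorable_insertI[of _ _ c _ _ a s]) (auto simp: insert_absorb)
  then show ?thesis using assms(2) by (simp add: insert_absorb)
qed

subsection \<open>Complementary graphs\<close>

text \<open>Edges need not lie inside \<open>V\<close>: connectivity and colorability only depend on those that do, so
  that deleting a vertex \<open>v\<close> simply means passing from \<open>V\<close> to \<open>V - {v}\<close>.\<close>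

locale complementary_graphs =
  fixes V :: "'a set" and E F :: "'a set set"
  assumes finite_vertices: "finite V"
    and complement_iff: "x \<in> V \<Longrightarrow> y \<in> V \<Longrightarrow> x \<noteq> y \<Longrightarrow> {x, y} \<in> F \<longleftrightarrow> {x, y} \<notin> E"
    and connected: "connected_graph V E"
    and connected_complement: "connected_graph V F"
begin

lemma swapped: "complementary_graphs V F E"
  by unfold_locales
    (simp_all add: finite_vertices complement_iff connected connected_complement)

lemma delete_vertex:
  assumes "connected_graph (V - {v}) E" "connected_graph (V - {v}) F"
  shows "complementary_graphs (V - {v}) E F"
  by unfold_locales (simp_all add: finite_vertices complement_iff assms)

lemma non_neighbors_complement: "v \<in> V \<Longrightarrow> non_neighbors V F v = neighbors V E v"
  using complement_iff[of v] by (auto simp: non_neighbors_def neighbors_def)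

lemma neighbors_complement: "v \<in> V \<Longrightarrow> neighbors V F v = non_neighbors V E v"
  using complement_iff[of v] by (auto simp: non_neighbors_def neighbors_def)

end

definition sum_colorable :: "'a set \<Rightarrow> 'a set set \<Rightarrow> 'a set set \<Rightarrow> nat \<Rightarrow> bool" where
  "sum_colorable V E F s \<longleftrightarrow>
     (\<exists>k l. rainbow_colorable V E k \<and> rainbow_colorable V F l \<and> k + l \<le> s)"

lemma sum_colorable_swap: "sum_colorable V E F s \<Longrightarrow> sum_colorable V F E s"
  unfolding sum_colorable_def by (metis add.commute)

lemma sum_colorableI:
  "rainbow_colorable V E k \<Longrightarrow> rainbow_colorable V F l \<Longrightarrow> k + l \<le> s \<Longrightarrow> sum_colorable V E F s"
  unfolding sum_colorable_def by blast

definition reducible :: "'a set \<Rightarrow> 'a set set \<Rightarrow> 'a set set \<Rightarrow> 'a \<Rightarrow> bool" where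
  "reducible V E F v \<longleftrightarrow> v \<in> V \<and> connected_graph (V - {v}) E \<and> connected_graph (V - {v}) F \<and>
     spread_out V F v"

context complementary_graphs
begin

lemma sum_colorable_by_degree:
  assumes spread: "v \<in> V" "spread_out V F v" and order: "3 \<le> card V"
    and colorable: "rainbow_colorable (V - {v}) F (max 3 (card (neighbors V E v) + 1))"
  shows "sum_colorable V E F (2 * card V)"
proof -
  let ?d = "card (neighbors V E v)"
  obtain w where "w \<in> V" "2 \<le> card (neighbors V E w)"
    using exists_degree_ge_2[OF finite_vertices connected order] by blast
  then obtain u where max_degree: "u \<in> V" "max 2 ?d \<le> card (neighbors V E u)"
    using spread(1) by (cases "2 \<le> ?d") auto
  have "finite (neighbors V E u)" using finite_vertices by (simp add: neighbors_def)
  then have "neighbors V E u \<noteq> {}" using max_degree(2) by auto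
  then have "rainbow_colorable V E (2 * card V - 1 - card (neighbors V E u))"
    by (rule rainbow_colorable_neighbors[OF finite_vertices connected max_degree(1) subset_refl])
  moreover have "rainbow_colorable V F (max 3 (?d + 1))"
    by (rule rainbow_colorable_extend[OF finite_vertices spread colorable])
      (simp_all add: non_neighbors_complement spread(1))
  moreover have "card (neighbors V E u) < card V"
    using finite_vertices max_degree(1) by (intro psubset_card_mono) (auto simp: neighbors_def)
  then have "2 * card V - 1 - card (neighbors V E u) + max 3 (?d + 1) \<le> 2 * card V"
    using max_degree(2) by linarith
  ultimately show ?thesis by (rule sum_colorableI)
qed

lemma sum_colorable_reducible:
  assumes reducible: "reducible V E F v" and order: "3 \<le> card V"
    and rest: "sum_colorable (V - {v}) E F (2 * (card V - 1))"
  shows "sum_colorable V E F (2 * card V)"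
proof -
  let ?d = "card (neighbors V E v)"
  obtain k l where colors: "rainbow_colorable (V - {v}) E k" "rainbow_colorable (V - {v}) F l"
    "k + l \<le> 2 * (card V - 1)"
    using rest unfolding sum_colorable_def by blast
  have spread: "v \<in> V" "connected_graph (V - {v}) E" "spread_out V F v"
    using reducible by (simp_all add: reducible_def)
  show ?thesis
  proof (cases "max 3 (?d + 1) \<le> l")
    case True
    have "rainbow_colorable V E (k + 2 * card (V - (V - {v})))"
      by (rule rainbow_colorable_grow[OF finite_vertices connected colors(1)])
        (use spread(2) in \<open>auto simp: connected_graph_def\<close>)
    moreover have "V - (V - {v}) = {v}" using spread(1) by blast
    ultimately have "rainbow_colorable V E (k + 2)" by simp
    moreover have "rainbow_colorable V F l"
      by (rule rainbow_colorable_extend[OF finite_vertices spread(1,3) colors(2)])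
        (use True in \<open>simp_all add: non_neighbors_complement spread(1)\<close>)
    moreover have "k + 2 + l \<le> 2 * card V" using colors(3) order by simp
    ultimately show ?thesis by (rule sum_colorableI)
  next
    case False
    then have "rainbow_colorable (V - {v}) F (max 3 (?d + 1))"
      using colors(2) rainbow_colorable_le by fastforce
    then show ?thesis by (rule sum_colorable_by_degree[OF spread(1,3) order])
  qed
qed

subsection \<open>Reducible vertices\<close>

lemma complement_join_if_cut_vertex:
  assumes "v \<in> V" "V \<noteq> {v}" "\<not> connected_graph (V - {v}) E"
  obtains S T where "S \<noteq> {}" "T \<noteq> {}" "S \<inter> T = {}" "S \<union> T = V - {v}"
    "\<And>x y. x \<in> S \<Longrightarrow> y \<in> T \<Longrightarrow> {x, y} \<in> F"
proof -
  have "V - {v} \<noteq> {}" using assms(1,2) by blast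
  then obtain S where part: "S \<subset> V - {v}" "S \<noteq> {}"
    and uncrossed: "\<And>x y. x \<in> S \<Longrightarrow> y \<in> V - {v} - S \<Longrightarrow> {x, y} \<notin> E"
    using connected_graph_cutI[of "V - {v}" E] assms(3) by blast
  have "{x, y} \<in> F" if "x \<in> S" "y \<in> V - {v} - S" for x y
    using uncrossed[OF that] complement_iff[of x y] part(1) that by auto
  then show ?thesis using part by (intro that[of S "V - {v} - S"]) auto
qed

lemma cut_vertex_of_join:
  assumes v_in: "v \<in> V" and u_neighbor: "u \<in> V - {v}" "{v, u} \<in> F"
    and join: "S \<noteq> {}" "T \<noteq> {}" "S \<union> T = V - {v}" "\<And>x y. x \<in> S \<Longrightarrow> y \<in> T \<Longrightarrow> {x, y} \<in> F"
    and cut: "\<not> connected_graph (V - {w}) F"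
  shows "w = u \<or> S = {w} \<or> T = {w}"
proof (rule ccontr)
  assume other: "\<not> (w = u \<or> S = {w} \<or> T = {w})"
  then have "connected_graph ((S - {w}) \<union> (T - {w})) F"
    using join(1,2,4) by (intro connected_graph_join) auto
  then have rest: "connected_graph (V - {v} - {w}) F"
    using join(3) by (simp flip: Un_Diff)
  show False
  proof (cases "w = v")
    case True
    then show False using rest cut by simp
  next
    case False
    have "connected_graph (insert v (V - {v} - {w})) F"
      using u_neighbor other
      by (intro connected_graph_insert[OF rest, of u]) (auto simp: insert_commute)
    moreover have "insert v (V - {v} - {w}) = V - {w}" using v_in False by blast
    ultimately show False using cut by simp
  qed
qed

lemma card_cut_vertices_complement:
  assumes cut: "v \<in> V" "\<not> connected_graph (V - {v}) E" and order: "4 \<le> card V"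
  shows "card {w \<in> V. \<not> connected_graph (V - {w}) F} \<le> 2"
proof -
  have "V \<noteq> {v}" using order by auto
  then obtain S T where parts: "S \<noteq> {}" "T \<noteq> {}" "S \<inter> T = {}" "S \<union> T = V - {v}"
    and join: "\<And>x y. x \<in> S \<Longrightarrow> y \<in> T \<Longrightarrow> {x, y} \<in> F"
    using complement_join_if_cut_vertex[OF cut(1) _ cut(2)] by blast
  obtain u where u_neighbor: "u \<in> V - {v}" "{v, u} \<in> F"
    using neighbors_nonempty[OF connected_complement cut(1)] order by (auto simp: neighbors_def)
  let ?A = "{w. S = {w} \<or> T = {w}}"
  have "card S + card T = card V - 1"
    using card_Un_disjoint[OF _ _ parts(3)] finite_vertices cut(1) parts(4)
    by (metis card_Diff_singleton finite_Diff finite_Un)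
  then have "card S \<noteq> 1 \<or> card T \<noteq> 1" using order by linarith
  then have "w = w'" if "w \<in> ?A" "w' \<in> ?A" for w w' using that by auto
  moreover have finite_A: "finite ?A"
    using parts(4) finite_vertices by (intro finite_subset[of ?A V]) auto
  ultimately have "card ?A \<le> 1" by (simp add: card_le_Suc0_iff_eq)
  have "{w \<in> V. \<not> connected_graph (V - {w}) F} \<subseteq> insert u ?A"
    using cut_vertex_of_join[OF cut(1) u_neighbor parts(1,2,4) join] by blast
  then have "card {w \<in> V. \<not> connected_graph (V - {w}) F} \<le> card (insert u ?A)"
    using finite_A by (intro card_mono) simp_all
  also have "\<dots> \<le> 2" using finite_A \<open>card ?A \<le> 1\<close> by (simp add: card_insert_if)
  finally show ?thesis .
qed

lemma exists_common_noncut_vertex: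
  assumes order: "5 \<le> card V"
  shows "\<exists>v\<in>V. connected_graph (V - {v}) E \<and> connected_graph (V - {v}) F"
proof (rule ccontr)
  assume all_cut: "\<not> ?thesis"
  let ?cut = "\<lambda>G. {w \<in> V. \<not> connected_graph (V - {w}) G}"
  have "\<exists>v\<in>V. \<not> connected_graph (V - {v}) E" "\<exists>v\<in>V. \<not> connected_graph (V - {v}) F"
    using exists_noncut_vertex[OF finite_vertices connected]
      exists_noncut_vertex[OF finite_vertices connected_complement] order all_cut by auto
  then have "card (?cut F) \<le> 2" "card (?cut E) \<le> 2"
    using card_cut_vertices_complement order
      complementary_graphs.card_cut_vertices_complement[OF swapped] by auto
  moreover have "V \<subseteq> ?cut E \<union> ?cut F" using all_cut by blast
  then have "card V \<le> card (?cut E) + card (?cut F)"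
    by (intro order_trans[OF card_mono card_Un_le]) (use finite_vertices in simp_all)
  ultimately show False using order by linarith
qed

lemma spread_out_or_unique_relay:
  assumes v_in: "v \<in> V" "2 \<le> card V" and relay: "relay V F v m"
  shows "spread_out V F v \<or>
    (\<exists>w\<in>neighbors V F v. \<forall>x\<in>neighbors V E v. \<forall>y\<in>neighbors V F v. {x, y} \<in> F \<longleftrightarrow> y = w)"
proof (intro disjCI)
  let ?N = "neighbors V E v" and ?M = "neighbors V F v"
  assume "\<not> (\<exists>w\<in>?M. \<forall>x\<in>?N. \<forall>y\<in>?M. {x, y} \<in> F \<longleftrightarrow> y = w)"
  have m_relay: "m x \<in> ?M \<and> {m x, x} \<in> F" if "x \<in> ?N" for x
    using relay that by (simp add: relay_def non_neighbors_complement v_in(1))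
  obtain a where a_neighbor: "a \<in> ?N" using neighbors_nonempty[OF connected v_in] by blast
  show "spread_out V F v"
  proof (cases "card ?N = 1 \<or> (\<exists>b\<in>?N. m b \<noteq> m a)")
    case True
    then show ?thesis
      using relay a_neighbor unfolding spread_out_def non_neighbors_complement[OF v_in(1)] by blast
  next
    case False
    then have same_relay: "m b = m a" if "b \<in> ?N" for b using that by blast
    obtain x y where other_relay: "x \<in> ?N" "y \<in> ?M" "{x, y} \<in> F \<longleftrightarrow> y \<noteq> m a"
      using \<open>\<not> (\<exists>w\<in>?M. _ w)\<close> m_relay[OF a_neighbor] by blast
    then have relay_edge: "{y, x} \<in> F" "y \<noteq> m a"
      using m_relay[OF other_relay(1)] same_relay[OF other_relay(1)] by (auto simp: insert_commute)
    have "?N \<noteq> {x}" using False by auto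
    then obtain b where b_neighbor: "b \<in> ?N" "b \<noteq> x" using other_relay(1) by blast
    have "relay V F v (m(x := y))"
      using m_relay other_relay(2) relay_edge(1)
      by (simp add: relay_def non_neighbors_complement v_in(1))
    moreover have "(m(x := y)) b \<noteq> (m(x := y)) x"
      using b_neighbor(2) same_relay[OF b_neighbor(1)] relay_edge(2) by simp
    ultimately show ?thesis
      using b_neighbor(1) other_relay(1)
      unfolding spread_out_def non_neighbors_complement[OF v_in(1)] by blast
  qed
qed

lemma vertex_cases:
  assumes "v \<in> V" "y \<in> V"
  obtains "y = v" | "y \<in> neighbors V E v" | "y \<in> neighbors V F v"
  using assms complement_iff[OF assms] by (auto simp: neighbors_def)

lemma neighbors_complement_disjoint: "v \<in> V \<Longrightarrow> x \<in> neighbors V E v \<Longrightarrow> x \<notin> neighbors V F v"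
  by (simp add: neighbors_complement non_neighbors_def)

context
  fixes v w
  assumes v_in: "v \<in> V" and hub: "w \<in> neighbors V F v"
    and unique_relay: "\<And>x y. x \<in> neighbors V E v \<Longrightarrow> y \<in> neighbors V F v \<Longrightarrow> {x, y} \<in> F \<longleftrightarrow> y = w"
begin

lemma join_except_relay:
  assumes "x \<in> neighbors V E v" "y \<in> neighbors V F v" "y \<noteq> w"
  shows "{x, y} \<in> E"
  using assms unique_relay[OF assms(1,2)] complement_iff[of x y]
    neighbors_complement_disjoint[OF v_in]
  by (auto simp: neighbors_def)

lemma relay_neighbor:
  obtains w' where "w' \<in> neighbors V F v" "w' \<noteq> w" "{w, w'} \<in> E"
proof -
  have "w \<in> V" "w \<noteq> v" "{v, w} \<in> F" using hub by (auto simp: neighbors_def)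
  then have "2 \<le> card V" using v_in finite_vertices card_mono[of V "{v, w}"] by auto
  then obtain w' where "w' \<in> neighbors V E w"
    using neighbors_nonempty[OF connected \<open>w \<in> V\<close>] by blast
  then have "w' \<in> V" "w' \<noteq> w" "{w, w'} \<in> E" "{w', w} \<notin> F"
    using complement_iff[of w w'] \<open>w \<in> V\<close> by (auto simp: neighbors_def insert_commute)
  moreover have "w' \<noteq> v" using calculation \<open>{v, w} \<in> F\<close> by auto
  moreover have "w' \<notin> neighbors V E v" using calculation unique_relay[OF _ hub, of w'] by blast
  ultimately show ?thesis using that vertex_cases[OF v_in] by blast
qed

lemma connected_delete_served:
  assumes served: "x \<in> neighbors V E v" "x' \<in> neighbors V E v" "x' \<noteq> x"
  shows "connected_graph (V - {x}) E"
proof -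
  let ?N = "neighbors V E v" and ?M = "neighbors V F v"
  obtain w' where hub_neighbor: "w' \<in> ?M" "w' \<noteq> w" "{w, w'} \<in> E" by (rule relay_neighbor)
  have "x \<notin> ?M" using neighbors_complement_disjoint[OF v_in served(1)] .
  have "v \<noteq> x" "{x', v} \<in> E" using served by (auto simp: neighbors_def insert_commute)
  have "connected_graph ({x', v} \<union> (?M - {w})) E"
  proof (rule connected_graph_dominating[OF connected_graph_singleton[of x']])
    fix y assume "y \<in> {x', v} \<union> (?M - {w}) - {x'}"
    then show "\<exists>s\<in>{x'}. {s, y} \<in> E"
      using join_except_relay[OF served(2)] \<open>{x', v} \<in> E\<close> by auto
  qed simp
  then show ?thesis
  proof (rule connected_graph_dominating)
    show "{x', v} \<union> (?M - {w}) \<subseteq> V - {x}"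
      using served v_in \<open>x \<notin> ?M\<close> \<open>v \<noteq> x\<close> by (auto simp: neighbors_def)
    fix y assume "y \<in> V - {x} - ({x', v} \<union> (?M - {w}))"
    then consider "y \<in> ?N" | "y = w" using vertex_cases[OF v_in] by blast
    then show "\<exists>s\<in>{x', v} \<union> (?M - {w}). {s, y} \<in> E"
      using hub_neighbor by cases (auto simp: neighbors_def insert_commute)
  qed
qed

lemma connected_complement_delete_served:
  assumes served: "x \<in> neighbors V E v"
  shows "connected_graph (V - {x}) F"
proof -
  let ?N = "neighbors V E v" and ?M = "neighbors V F v"
  have "v \<noteq> x" "x \<notin> ?M" "{v, w} \<in> F"
    using hub served neighbors_complement_disjoint[OF v_in] by (auto simp: neighbors_def)
  have "connected_graph ({w, v} \<union> (?N - {x})) F"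
  proof (rule connected_graph_dominating[OF connected_graph_singleton[of w]])
    fix y assume "y \<in> {w, v} \<union> (?N - {x}) - {w}"
    then show "\<exists>s\<in>{w}. {s, y} \<in> F"
      using unique_relay[OF _ hub, of y] \<open>{v, w} \<in> F\<close> by (auto simp: insert_commute)
  qed simp
  then show ?thesis
  proof (rule connected_graph_dominating)
    show "{w, v} \<union> (?N - {x}) \<subseteq> V - {x}"
      using hub v_in \<open>v \<noteq> x\<close> \<open>x \<notin> ?M\<close> by (auto simp: neighbors_def)
    fix y assume "y \<in> V - {x} - ({w, v} \<union> (?N - {x}))"
    then have "y \<in> ?M" using vertex_cases[OF v_in] by blast
    then show "\<exists>s\<in>{w, v} \<union> (?N - {x}). {s, y} \<in> F" by (simp add: neighbors_def)
  qed
qed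

lemma spread_out_served:
  assumes served: "x \<in> neighbors V E v"
  shows "spread_out V E x"
proof -
  let ?N = "neighbors V E v" and ?M = "neighbors V F v"
  obtain w' where hub_neighbor: "w' \<in> ?M" "w' \<noteq> w" "{w, w'} \<in> E" by (rule relay_neighbor)
  have served_vertex: "x \<in> V" "v \<noteq> x" "x \<noteq> w" "x \<noteq> w'" "{v, x} \<in> E"
    using served hub hub_neighbor(1) neighbors_complement_disjoint[OF v_in]
    by (auto simp: neighbors_def)
  have x_neighbors: "v \<in> neighbors V E x" "\<And>y. y \<in> ?M \<Longrightarrow> y \<noteq> w \<Longrightarrow> y \<in> neighbors V E x"
    using served_vertex v_in join_except_relay[OF served]
      neighbors_complement_disjoint[OF v_in served]
    by (auto simp: neighbors_def insert_commute)
  have w_non_neighbor: "w \<in> non_neighbors V E x"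
    using unique_relay[OF served hub] complement_iff[of x w] hub served_vertex
    by (auto simp: non_neighbors_def neighbors_def)
  have non_neighbor_cases: "y \<in> ?N" if "y \<in> non_neighbors V E x" "y \<noteq> w" for y
    using that x_neighbors vertex_cases[OF v_in] unfolding non_neighbors_def by blast
  let ?m = "\<lambda>y. if y = w then w' else v"
  have relay: "relay V E x ?m"
    using x_neighbors hub_neighbor non_neighbor_cases
    by (auto simp: relay_def neighbors_def insert_commute)
  show ?thesis
  proof (cases "non_neighbors V E x = {w}")
    case True
    then show ?thesis unfolding spread_out_def by (intro exI[of _ ?m]) (simp add: relay)
  next
    case False
    then obtain y where "y \<in> non_neighbors V E x" "y \<noteq> w" using w_non_neighbor by blast
    moreover from this have "?m y \<noteq> ?m w" using hub_neighbor(1) by (auto simp: neighbors_def)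
    ultimately show ?thesis using relay w_non_neighbor unfolding spread_out_def by blast
  qed
qed

end

lemma exists_reducible_if_relay:
  assumes noncut: "v \<in> V" "connected_graph (V - {v}) E" "connected_graph (V - {v}) F"
    and order: "2 \<le> card V" and relay: "relay V F v m"
  shows "\<exists>x. reducible V E F x \<or> reducible V F E x"
proof (cases "spread_out V F v")
  case True
  then show ?thesis using noncut by (auto simp: reducible_def)
next
  case False
  then obtain w where hub: "w \<in> neighbors V F v"
    "\<And>x y. x \<in> neighbors V E v \<Longrightarrow> y \<in> neighbors V F v \<Longrightarrow> {x, y} \<in> F \<longleftrightarrow> y = w"
    using spread_out_or_unique_relay[OF noncut(1) order relay] by blast
  obtain x where served: "x \<in> neighbors V E v"
    using neighbors_nonempty[OF connected noncut(1) order] by blast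
  have "neighbors V E v \<noteq> {x}"
    using False relay by (auto simp: spread_out_def non_neighbors_complement noncut(1))
  then obtain x' where other_served: "x' \<in> neighbors V E v" "x' \<noteq> x" using served by blast
  have "x \<in> V" using served by (simp add: neighbors_def)
  then have "reducible V F E x"
    using connected_delete_served[OF noncut(1) hub served other_served]
      connected_complement_delete_served[OF noncut(1) hub served]
      spread_out_served[OF noncut(1) hub served] by (simp add: reducible_def)
  then show ?thesis by blast
qed

lemma exists_reducible:
  assumes order_ge_5: "5 \<le> card V"
  shows "\<exists>v. reducible V E F v \<or> reducible V F E v"
proof -
  obtain v where noncut: "v \<in> V" "connected_graph (V - {v}) E" "connected_graph (V - {v}) F"
    using exists_common_noncut_vertex[OF order_ge_5] by blast
  have order: "2 \<le> card V" using order_ge_5 by simp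
  show ?thesis
  proof (cases "\<forall>x\<in>neighbors V E v. \<exists>y\<in>neighbors V F v. {y, x} \<in> F")
    case True
    then obtain m where "relay V F v m"
      unfolding relay_def non_neighbors_complement[OF noncut(1)] by metis
    then show ?thesis by (rule exists_reducible_if_relay[OF noncut order])
  next
    case False
    then obtain x where unreached: "x \<in> neighbors V E v" "\<And>y. y \<in> neighbors V F v \<Longrightarrow> {y, x} \<notin> F"
      by blast
    have "{x, y} \<in> E" if y_neighbor: "y \<in> neighbors V F v" for y
    proof -
      have "y \<noteq> x"
        using y_neighbor neighbors_complement_disjoint[OF noncut(1) unreached(1)] by blast
      moreover have "x \<in> V" "y \<in> V" using unreached(1) y_neighbor by (simp_all add: neighbors_def)
      ultimately show ?thesis
        using unreached(2)[OF y_neighbor] complement_iff[of x y] by (simp add: insert_commute)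
    qed
    then have "relay V E v (\<lambda>_. x)"
      using unreached(1) by (simp add: relay_def flip: neighbors_complement[OF noncut(1)])
    then show ?thesis
      using complementary_graphs.exists_reducible_if_relay[OF swapped noncut(1,3,2) order] by blast
  qed
qed

end

subsection \<open>Small graphs\<close>

lemma rainbow_colorable_by_paths:
  assumes "\<And>z. c z < k" and proper: "\<forall>e\<in>E. \<forall>x\<in>e. c (Inl x) \<noteq> c (Inr e)"
    and paths: "\<forall>p\<in>set P. path_between V E (hd p) p (last p) \<and> total_rainbow c p"
    and pairs: "\<forall>u\<in>V. \<forall>v\<in>V. u = v \<or> {u, v} \<in> E \<or>
      (\<exists>p\<in>set P. hd p = u \<and> last p = v \<or> hd p = v \<and> last p = u)"
  shows "rainbow_colorable V E k"
proof -
  have "total_rainbow_connected V E c"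
  proof (rule total_rainbow_connected_symI)
    fix u v assume endpoints: "u \<in> V" "v \<in> V" "u \<noteq> v"
    then consider "{u, v} \<in> E"
      | p where "p \<in> set P" "hd p = u \<and> last p = v \<or> hd p = v \<and> last p = u"
      using pairs by metis
    then show "\<exists>p. (path_between V E u p v \<or> path_between V E v p u) \<and> total_rainbow c p"
    proof cases
      assume "{u, v} \<in> E"
      then have "path_between V E u [u, v] v" using endpoints by (intro path_between_edge)
      then show ?thesis using total_rainbow_edge by (intro exI conjI disjI1)
    qed (use paths in blast)
  qed
  moreover have "incidence_proper V E c"
    using proper by (simp add: incidence_proper_def neighbors_def)
  ultimately show ?thesis unfolding rainbow_colorable_def using assms(1) by blast
qed

lemma lessThan_5: "{..<5 :: nat} = {0, 1, 2, 3, 4}"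
  by auto

lemma lessThan_6: "{..<6 :: nat} = {0, 1, 2, 3, 4, 5}"
  by auto

lemmas rainbow_path_simps =
  path_between_def total_rainbow_def internal_vertices_def doubleton_eq_iff

lemma rainbow_colorable_house:
  "rainbow_colorable {..<5 :: nat} {{0, 2}, {0, 3}, {1, 3}, {1, 4}, {2, 4}, {3, 4}} 3"
  by (rule rainbow_colorable_by_paths[where
        c = "(\<lambda>_. 0)(Inl 0 := 2, Inl 1 := 1, Inl 2 := 2, Inl 3 := 2, Inl 4 := 2,
          Inr {0, 3} := 1, Inr {2, 4} := 1)" and
        P = "[[0, 2, 4], [2, 0, 3], [0, 3, 1], [1, 4, 2]]"])
    (simp_all add: lessThan_5 rainbow_path_simps)

lemma rainbow_colorable_cofork:
  "rainbow_colorable {..<5 :: nat} {{0, 2}, {0, 3}, {0, 4}, {1, 3}, {2, 4}, {3, 4}} 5"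
  by (rule rainbow_colorable_by_paths[where
        c = "(\<lambda>_. 0)(Inl 0 := 4, Inl 3 := 2, Inl 4 := 1, Inr {0, 2} := 3,
          Inr {1, 3} := 1, Inr {2, 4} := 2)" and
        P = "[[0, 3, 1], [1, 3, 4], [1, 3, 0, 2], [2, 0, 3]]"])
    (simp_all add: lessThan_5 rainbow_path_simps)

lemma rainbow_colorable_tailed_triangle:
  "rainbow_colorable {..<5 :: nat} {{0, 1}, {0, 4}, {1, 2}, {1, 4}, {2, 3}} 5"
  by (rule rainbow_colorable_by_paths[where
        c = "(\<lambda>_. 0)(Inl 1 := 4, Inl 2 := 2, Inr {0, 1} := 3, Inr {0, 4} := 1,
          Inr {1, 4} := 3, Inr {2, 3} := 1)" and
        P = "[[1, 2, 3], [0, 1, 2], [0, 1, 2, 3], [2, 1, 4], [3, 2, 1, 4]]"])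
    (simp_all add: lessThan_5 rainbow_path_simps)

lemma rainbow_colorable_banner:
  "rainbow_colorable {..<5 :: nat} {{0, 2}, {0, 3}, {1, 3}, {2, 4}, {3, 4}} 5"
  by (rule rainbow_colorable_by_paths[where
        c = "(\<lambda>_. 0)(Inl 0 := 1, Inl 2 := 1, Inl 3 := 2, Inl 4 := 4, Inr {1, 3} := 1,
          Inr {2, 4} := 3)" and
        P = "[[0, 3, 1], [0, 2, 4], [1, 3, 4, 2], [1, 3, 4], [2, 4, 3]]"])
    (simp_all add: lessThan_5 rainbow_path_simps)

lemma rainbow_colorable_pentagon:
  "rainbow_colorable {..<5 :: nat} {{0, 1}, {0, 4}, {1, 2}, {2, 3}, {3, 4}} 5"
  by (rule rainbow_colorable_by_paths[where
        c = "(\<lambda>_. 0)(Inl 0 := 1, Inl 1 := 2, Inl 2 := 3, Inl 3 := 4, Inl 4 := 1,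
          Inr {1, 2} := 1, Inr {3, 4} := 2)" and
        P = "[[0, 1, 2], [0, 4, 3], [1, 2, 3], [1, 2, 3, 4], [2, 3, 4]]"])
    (simp_all add: lessThan_5 rainbow_path_simps)

lemma rainbow_colorable_bull:
  "rainbow_colorable {..<5 :: nat} {{0, 1}, {1, 2}, {1, 4}, {2, 3}, {2, 4}} 5"
  by (rule rainbow_colorable_by_paths[where
        c = "(\<lambda>_. 0)(Inl 0 := 1, Inl 1 := 2, Inl 2 := 4, Inl 4 := 2, Inr {1, 2} := 1,
          Inr {1, 4} := 1, Inr {2, 3} := 3)" and
        P = "[[0, 1, 2], [0, 1, 2, 3], [0, 1, 4], [1, 2, 3], [3, 2, 4]]"])
    (simp_all add: lessThan_5 rainbow_path_simps)

lemma rainbow_colorable_cofork_pentagon: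
  "rainbow_colorable {..<6 :: nat} {{0, 4}, {0, 5}, {1, 2}, {1, 3}, {1, 5}, {2, 3}, {2, 4}, {3, 4}} 4"
  by (rule rainbow_colorable_by_paths[where
        c = "(\<lambda>_. 0)(Inl 0 := 1, Inl 1 := 2, Inl 2 := 2, Inl 3 := 2, Inl 5 := 2,
          Inr {0, 4} := 2, Inr {1, 5} := 1, Inr {2, 4} := 1, Inr {3, 4} := 1)" and
        P = "[[0, 5, 1], [1, 2, 4], [4, 0, 5], [0, 4, 2], [0, 4, 3], [2, 1, 5], [3, 1, 5]]"])
    (simp_all add: lessThan_6 rainbow_path_simps)

lemma rainbow_colorable_cofork_pendant_tip:
  "rainbow_colorable {..<6 :: nat} {{0, 4}, {1, 2}, {1, 3}, {2, 3}, {2, 4}, {3, 4}, {4, 5}} 5"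
  by (rule rainbow_colorable_by_paths[where
        c = "(\<lambda>_. 0)(Inl 0 := 1, Inl 1 := 1, Inl 2 := 4, Inl 3 := 4, Inl 4 := 2,
          Inr {1, 2} := 3, Inr {2, 4} := 1, Inr {3, 4} := 3, Inr {4, 5} := 1)" and
        P = "[[0, 4, 5], [0, 4, 2], [0, 4, 3], [2, 3, 4, 5], [3, 4, 5], [0, 4, 2, 1],
          [1, 2, 4], [1, 3, 4, 5]]"])
    (simp_all add: lessThan_6 rainbow_path_simps)

lemma rainbow_colorable_cofork_pendant_side:
  "rainbow_colorable {..<6 :: nat} {{0, 4}, {1, 2}, {1, 3}, {2, 3}, {2, 4}, {2, 5}, {3, 4}} 5"
  by (rule rainbow_colorable_by_paths[where
        c = "(\<lambda>_. 0)(Inl 0 := 1, Inl 1 := 1, Inl 2 := 4, Inl 3 := 4, Inl 4 := 2,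
          Inr {1, 3} := 3, Inr {2, 4} := 1, Inr {2, 5} := 3, Inr {3, 4} := 1)" and
        P = "[[0, 4, 2], [0, 4, 3], [0, 4, 2, 5], [1, 2, 5], [3, 2, 5], [4, 2, 5],
          [0, 4, 3, 1], [1, 2, 4]]"])
    (simp_all add: lessThan_6 rainbow_path_simps)

lemma rainbow_colorable_double_star:
  "rainbow_colorable {..<6 :: nat} {{0, 1}, {0, 2}, {0, 3}, {1, 4}, {1, 5}} 7"
  by (rule rainbow_colorable_by_paths[where
        c = "(\<lambda>_. 0)(Inl 0 := 5, Inl 1 := 2, Inr {0, 2} := 4, Inr {0, 3} := 6,
          Inr {1, 4} := 1, Inr {1, 5} := 3)" and
        P = "[[0, 1, 4], [0, 1, 5], [1, 0, 2], [1, 0, 3], [2, 0, 3], [2, 0, 1, 4],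
          [2, 0, 1, 5], [3, 0, 1, 4], [3, 0, 1, 5], [4, 1, 5]]"])
    (simp_all add: lessThan_6 rainbow_path_simps)

lemma rainbow_colorable_fork_joined_except_center:
  "rainbow_colorable {..<6 :: nat} {{0, 1}, {0, 2}, {0, 3}, {1, 4}, {1, 5}, {2, 5}, {3, 5}, {4, 5}} 4"
  by (rule rainbow_colorable_by_paths[where
        c = "(\<lambda>_. 0)(Inl 0 := 2, Inl 1 := 2, Inl 2 := 2, Inl 5 := 2, Inr {0, 2} := 1,
          Inr {0, 3} := 1, Inr {1, 4} := 1, Inr {1, 5} := 1, Inr {3, 5} := 1,
          Inr {4, 5} := 3)" and
        P = "[[0, 1, 5], [0, 1, 4], [1, 0, 2], [1, 0, 3], [2, 5, 3], [2, 5, 4], [3, 5, 4]]"])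
    (simp_all add: lessThan_6 rainbow_path_simps)

lemma rainbow_colorable_fork_joined_except_neighbor:
  "rainbow_colorable {..<6 :: nat} {{0, 1}, {0, 2}, {0, 3}, {0, 5}, {1, 4}, {2, 5}, {3, 5}, {4, 5}} 4"
  by (rule rainbow_colorable_by_paths[where
        c = "(\<lambda>_. 0)(Inl 0 := 2, Inl 1 := 2, Inl 2 := 2, Inl 5 := 2, Inr {0, 2} := 1,
          Inr {0, 3} := 1, Inr {0, 5} := 1, Inr {1, 4} := 1, Inr {3, 5} := 1,
          Inr {4, 5} := 3)" and
        P = "[[0, 1, 4], [1, 0, 5], [1, 0, 2], [1, 0, 3], [2, 5, 3], [2, 5, 4], [3, 5, 4]]"])
    (simp_all add: lessThan_6 rainbow_path_simps)

subsection \<open>Order four\<close>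

definition induced_path4 ::
    "'a set \<Rightarrow> 'a set set \<Rightarrow> 'a set set \<Rightarrow> 'a \<Rightarrow> 'a \<Rightarrow> 'a \<Rightarrow> 'a \<Rightarrow> bool" where
  "induced_path4 V E F a b c d \<longleftrightarrow> distinct [a, b, c, d] \<and> V = {a, b, c, d} \<and>
     {{a, b}, {b, c}, {c, d}} \<subseteq> E \<and> {{a, c}, {a, d}, {b, d}} \<subseteq> F"

lemma induced_path4_complement: "induced_path4 V E F a b c d \<Longrightarrow> induced_path4 V F E b d a c"
  by (auto simp: induced_path4_def insert_commute)

context complementary_graphs
begin

lemma induced_path4_if_degree_two:
  assumes order: "card V = 4" and path_end: "p \<in> V" "2 \<le> card (neighbors V F p)"
  shows "\<exists>a b c d. induced_path4 V E F a b c d"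
proof -
  obtain r s where end_non_neighbors: "{r, s} \<subseteq> neighbors V F p" "r \<noteq> s"
    using obtain_subset_with_card_n[OF path_end(2)] by (metis card_2_iff)
  obtain q where end_neighbor: "q \<in> neighbors V E p"
    using neighbors_nonempty[OF connected path_end(1)] order by auto
  have distinct: "distinct [p, q, r, s]"
    using end_non_neighbors end_neighbor neighbors_complement_disjoint[OF path_end(1) end_neighbor]
    by (auto simp: neighbors_def)
  have "{p, q, r, s} \<subseteq> V"
    using path_end(1) end_non_neighbors(1) end_neighbor by (auto simp: neighbors_def)
  moreover have "card {p, q, r, s} = card V" using distinct order by simp
  ultimately have V_eq: "V = {p, q, r, s}"
    using card_subset_eq[OF finite_vertices, of "{p, q, r, s}"] by simp
  have end_non_edges: "{p, r} \<notin> E" "{p, s} \<notin> E"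
    using end_non_neighbors(1) path_end(1) complement_iff[of p] by (auto simp: neighbors_def)
  have "\<not> V \<subseteq> {p, q}" "{p, q} \<inter> V \<noteq> {}" using V_eq distinct by auto
  then obtain x y where "x \<in> {p, q} \<inter> V" "y \<in> V - {p, q}" "{x, y} \<in> E"
    by (metis connected connected_graph_cut)
  then have third: "y \<in> {r, s}" "{q, y} \<in> E" using V_eq end_non_edges by auto
  define z where "z = (if y = r then s else r)"
  have fourth: "distinct [p, q, y, z]" "V = {p, q, y, z}" "{p, y} \<in> F" "{p, z} \<in> F" "{p, z} \<notin> E"
    using third(1) distinct V_eq end_non_edges end_non_neighbors(1)
    by (auto simp: z_def neighbors_def)
  have "q \<in> V" "z \<in> V" "2 \<le> card V" using fourth(2) order by simp_all
  then have "neighbors V F q \<noteq> {}" "neighbors V E z \<noteq> {}"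
    using neighbors_nonempty[OF connected] neighbors_nonempty[OF connected_complement] by simp_all
  moreover have "{p, q} \<notin> F" "{q, y} \<notin> F"
    using end_neighbor third(2) complement_iff[of p q] complement_iff[of q y] fourth(1,2)
    by (auto simp: neighbors_def)
  ultimately have "{q, z} \<in> F" "{y, z} \<in> E"
    using fourth complement_iff[of q z] by (auto simp: neighbors_def insert_commute)
  then have "induced_path4 V E F p q y z"
    using fourth third(2) end_neighbor by (simp add: induced_path4_def neighbors_def)
  then show ?thesis by blast
qed

lemma exists_induced_path4:
  assumes order: "card V = 4"
  shows "\<exists>a b c d. induced_path4 V E F a b c d"
proof -
  obtain p where p_in: "p \<in> V" using connected by (auto simp: connected_graph_def)
  have "neighbors V E p \<subseteq> V - {p}" by (auto simp: neighbors_def)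
  then have "card (neighbors V F p) = card (V - {p}) - card (neighbors V E p)"
    unfolding neighbors_complement[OF p_in] non_neighbors_def
    by (rule card_Diff_subset[rotated]) (use finite_vertices in \<open>simp add: neighbors_def\<close>)
  then have "card (neighbors V F p) = 3 - card (neighbors V E p)" using order p_in by simp
  then consider "2 \<le> card (neighbors V F p)" | "2 \<le> card (neighbors V E p)" by linarith
  then show ?thesis
  proof cases
    assume "2 \<le> card (neighbors V E p)"
    then have "\<exists>a b c d. induced_path4 V F E a b c d"
      using complementary_graphs.induced_path4_if_degree_two[OF swapped order p_in] by blast
    then show ?thesis using induced_path4_complement by metis
  qed (use induced_path4_if_degree_two[OF order p_in] in blast)
qed

end

subsection \<open>Order five\<close>

definition fork_on ::
    "'a set \<Rightarrow> 'a set set \<Rightarrow> 'a set set \<Rightarrow> 'a \<Rightarrow> 'a \<Rightarrow> 'a \<Rightarrow> 'a \<Rightarrow> 'a \<Rightarrow> bool" where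
  "fork_on V E F p q r s t \<longleftrightarrow> distinct [p, q, r, s, t] \<and> V = {p, q, r, s, t} \<and>
     {{p, q}, {p, r}, {p, s}, {q, t}} \<subseteq> E \<and>
     {{p, t}, {q, r}, {q, s}, {r, s}, {r, t}, {s, t}} \<subseteq> F"

definition fork :: "'a set \<Rightarrow> 'a set set \<Rightarrow> 'a set set \<Rightarrow> bool" where
  "fork V E F \<longleftrightarrow> (\<exists>p q r s t. fork_on V E F p q r s t)"

definition path4_neighborhoods :: "'a \<Rightarrow> 'a \<Rightarrow> 'a \<Rightarrow> 'a \<Rightarrow> 'a set set" where
  "path4_neighborhoods a b c d = {{a}, {b}, {a, b}, {a, d}, {b, c}}"

context complementary_graphs
begin

lemma sum_colorable_fork:
  assumes "fork V E F"
  shows "sum_colorable V E F 11"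
proof -
  obtain p q r s t where vertices: "distinct [p, q, r, s, t]" "V = {p, q, r, s, t}"
    and edges: "{{p, q}, {p, r}, {p, s}, {q, t}} \<subseteq> E"
    and complement: "{{p, t}, {q, r}, {q, s}, {r, s}, {r, t}, {s, t}} \<subseteq> F"
    using assms unfolding fork_def fork_on_def by (elim exE conjE) (rule that)
  have "{q, r, s} \<subseteq> neighbors V E p" "card {q, r, s} = 3" "card V = 5"
    using vertices edges by (auto simp: neighbors_def)
  then have "rainbow_colorable V E 6"
    using rainbow_colorable_neighbors[OF finite_vertices connected, of p "{q, r, s}"] vertices(2)
    by simp
  moreover have "rainbow_colorable (set [r, p, q, t, s]) F 5"
    by (rule rainbow_colorable_embed[OF rainbow_colorable_cofork])
      (use vertices(1) complement in \<open>auto simp: insert_commute\<close>)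
  then have "rainbow_colorable V F 5" using vertices(2) by (simp add: insert_commute)
  ultimately show ?thesis by (rule sum_colorableI) simp
qed

context
  fixes a b c d v
  assumes v_in: "v \<in> V" and path: "induced_path4 (V - {v}) E F a b c d"
begin

lemma path4_insert_vertices: "distinct [a, b, c, d, v]" "V = {a, b, c, d, v}"
  using path v_in by (auto simp: induced_path4_def)

lemma path4_insert_edges: "{{a, b}, {b, c}, {c, d}} \<subseteq> E" "{{a, c}, {a, d}, {b, d}} \<subseteq> F"
  using path by (simp_all add: induced_path4_def)

lemma path4_insert_edge_iff:
  assumes "x \<in> {a, b, c, d}"
  shows "{x, v} \<in> E \<longleftrightarrow> x \<in> neighbors V E v" "{x, v} \<in> F \<longleftrightarrow> x \<notin> neighbors V E v"
  using assms path4_insert_vertices complement_iff[of x v]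
  by (auto simp: neighbors_def insert_commute)

lemma embed_order_5:
  assumes "rainbow_colorable {..<5} G\<^sub>0 k" "\<And>e. e \<in> G\<^sub>0 \<Longrightarrow> e \<subseteq> {..<5}" "3 \<le> k"
    and "(`) ((!) vs) ` G\<^sub>0 \<subseteq> G" "vs \<in> {[a, b, c, d, v], [b, d, a, c, v]}"
  shows "rainbow_colorable V G k"
proof -
  have "length vs = 5" "distinct vs" using assms(5) path4_insert_vertices(1) by auto
  moreover have "set vs = V"
    using assms(5) unfolding path4_insert_vertices(2)
    by (elim insertE) (simp_all add: insert_commute)
  ultimately show ?thesis using rainbow_colorable_embed[OF assms(1,2) _ _ assms(4,3)] by simp
qed

lemma sum_colorable_if_joined_to_end:
  assumes "neighbors V E v = {a}"
  shows "sum_colorable V E F 10"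
proof -
  have v_edges: "{a, v} \<in> E" "{b, v} \<in> F" "{c, v} \<in> F" "{d, v} \<in> F"
    using path4_insert_vertices(1) assms by (auto simp: path4_insert_edge_iff)
  have "{a, c} \<subseteq> neighbors V E b" "card {a, c} = 2" "card V = 5"
    using path4_insert_vertices path4_insert_edges by (auto simp: neighbors_def insert_commute)
  then have "rainbow_colorable V E 7"
    using rainbow_colorable_neighbors[OF finite_vertices connected, of b "{a, c}"]
      path4_insert_vertices(2) by simp
  moreover have "rainbow_colorable V F 3"
    by (rule embed_order_5[OF rainbow_colorable_house, of "[a, b, c, d, v]"])
      (use path4_insert_edges v_edges in \<open>auto simp: insert_commute\<close>)
  ultimately show ?thesis by (rule sum_colorableI) simp
qed

lemma fork_if_joined_to_inner:
  assumes "neighbors V E v = {b}"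
  shows "fork V E F"
proof -
  have v_edges: "{b, v} \<in> E" "{a, v} \<in> F" "{c, v} \<in> F" "{d, v} \<in> F"
    using path4_insert_vertices(1) assms by (auto simp: path4_insert_edge_iff)
  have "distinct [b, c, a, v, d]" "V = {b, c, a, v, d}" using path4_insert_vertices by auto
  moreover have "{{b, c}, {b, a}, {b, v}, {c, d}} \<subseteq> E"
    "{{b, d}, {c, a}, {c, v}, {a, v}, {a, d}, {v, d}} \<subseteq> F"
    using path4_insert_edges v_edges by (auto simp: insert_commute)
  ultimately have "fork_on V E F b c a v d" by (simp add: fork_on_def)
  then show ?thesis unfolding fork_def by blast
qed

lemma sum_colorable_if_joined_to_end_edge:
  assumes "neighbors V E v = {a, b}"
  shows "sum_colorable V E F 10"
proof -
  have v_edges: "{a, v} \<in> E" "{b, v} \<in> E" "{c, v} \<in> F" "{d, v} \<in> F"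
    using path4_insert_vertices(1) assms by (auto simp: path4_insert_edge_iff)
  have "rainbow_colorable V E 5"
    by (rule embed_order_5[OF rainbow_colorable_tailed_triangle, of "[a, b, c, d, v]"])
      (use path4_insert_edges v_edges in \<open>auto simp: insert_commute\<close>)
  moreover have "rainbow_colorable V F 5"
    by (rule embed_order_5[OF rainbow_colorable_banner, of "[a, b, c, d, v]"])
      (use path4_insert_edges v_edges in \<open>auto simp: insert_commute\<close>)
  ultimately show ?thesis by (rule sum_colorableI) simp
qed

lemma sum_colorable_if_joined_to_both_ends:
  assumes "neighbors V E v = {a, d}"
  shows "sum_colorable V E F 10"
proof -
  have v_edges: "{a, v} \<in> E" "{d, v} \<in> E" "{b, v} \<in> F" "{c, v} \<in> F"
    using path4_insert_vertices(1) assms by (auto simp: path4_insert_edge_iff)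
  have "rainbow_colorable V E 5"
    by (rule embed_order_5[OF rainbow_colorable_pentagon, of "[a, b, c, d, v]"])
      (use path4_insert_edges v_edges in \<open>auto simp: insert_commute\<close>)
  moreover have "rainbow_colorable V F 5"
    by (rule embed_order_5[OF rainbow_colorable_pentagon, of "[b, d, a, c, v]"])
      (use path4_insert_edges v_edges in \<open>auto simp: insert_commute\<close>)
  ultimately show ?thesis by (rule sum_colorableI) simp
qed

lemma sum_colorable_if_joined_to_inner_edge:
  assumes "neighbors V E v = {b, c}"
  shows "sum_colorable V E F 10"
proof -
  have v_edges: "{b, v} \<in> E" "{c, v} \<in> E" "{a, v} \<in> F" "{d, v} \<in> F"
    using path4_insert_vertices(1) assms by (auto simp: path4_insert_edge_iff)
  have "rainbow_colorable V E 5"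
    by (rule embed_order_5[OF rainbow_colorable_bull, of "[a, b, c, d, v]"])
      (use path4_insert_edges v_edges in \<open>auto simp: insert_commute\<close>)
  moreover have "rainbow_colorable V F 5"
    by (rule embed_order_5[OF rainbow_colorable_bull, of "[b, d, a, c, v]"])
      (use path4_insert_edges v_edges in \<open>auto simp: insert_commute\<close>)
  ultimately show ?thesis by (rule sum_colorableI) simp
qed

lemma sum_colorable_or_fork_path4_insert:
  assumes "neighbors V E v \<in> path4_neighborhoods a b c d"
  shows "sum_colorable V E F 10 \<or> fork V E F"
  using assms unfolding path4_neighborhoods_def
  using sum_colorable_if_joined_to_end fork_if_joined_to_inner
    sum_colorable_if_joined_to_end_edge sum_colorable_if_joined_to_both_ends
    sum_colorable_if_joined_to_inner_edge by blast

end

text \<open>The path of order four is self-complementary, so a fifth vertex is attached to it in one of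
  the ways of \<^const>\<open>path4_neighborhoods\<close>, up to reversal and complementation.\<close>

lemma proper_subset_path4_neighborhoods:
  assumes "distinct [a, b, c, d]" "N \<subseteq> {a, b, c, d}" "N \<noteq> {}" "{a, b, c, d} - N \<noteq> {}"
  shows "N \<in> path4_neighborhoods a b c d \<or> N \<in> path4_neighborhoods d c b a \<or>
    {a, b, c, d} - N \<in> path4_neighborhoods b d a c \<or>
    {a, b, c, d} - N \<in> path4_neighborhoods c a d b"
proof -
  have "N \<in> Pow {a, b, c, d}" "distinct [d, c, b, a]" using assms(1,2) by auto
  then show ?thesis
    using assms(1,3,4) unfolding Pow_insert Pow_empty path4_neighborhoods_def
    by (elim UnE imageE singletonE; simp add: insert_Diff_if insert_commute)
qed

lemma exists_path4_neighborhood: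
  assumes v_in: "v \<in> V" and order: "2 \<le> card V"
    and path: "induced_path4 (V - {v}) E F a b c d"
  shows "\<exists>a b c d.
    induced_path4 (V - {v}) E F a b c d \<and> neighbors V E v \<in> path4_neighborhoods a b c d \<or>
    induced_path4 (V - {v}) F E a b c d \<and> neighbors V F v \<in> path4_neighborhoods a b c d"
proof -
  have rest: "V - {v} = {a, b, c, d}" "distinct [a, b, c, d]"
    using path by (simp_all add: induced_path4_def)
  have neighbors_F: "neighbors V F v = {a, b, c, d} - neighbors V E v"
    using neighbors_complement[OF v_in] rest(1) by (simp add: non_neighbors_def)
  have "neighbors V E v \<noteq> {}" "neighbors V F v \<noteq> {}"
    using v_in order neighbors_nonempty[OF connected] neighbors_nonempty[OF connected_complement]
    by simp_all
  moreover have "neighbors V E v \<subseteq> {a, b, c, d}" using rest(1) by (auto simp: neighbors_def)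
  ultimately have "neighbors V E v \<in> path4_neighborhoods a b c d \<or>
      neighbors V E v \<in> path4_neighborhoods d c b a \<or>
      neighbors V F v \<in> path4_neighborhoods b d a c \<or>
      neighbors V F v \<in> path4_neighborhoods c a d b"
    using proper_subset_path4_neighborhoods[OF rest(2)] unfolding neighbors_F by blast
  moreover have "induced_path4 (V - {v}) E F d c b a" "induced_path4 (V - {v}) F E b d a c"
    "induced_path4 (V - {v}) F E c a d b"
    using path by (simp_all add: induced_path4_complement)
  ultimately show ?thesis using path by blast
qed

lemma sum_colorable_order_5:
  assumes order: "card V = 5"
  shows "sum_colorable V E F 10 \<or> fork V E F \<or> fork V F E"
proof -
  obtain v where noncut: "v \<in> V" "connected_graph (V - {v}) E" "connected_graph (V - {v}) F"
    using exists_common_noncut_vertex order by auto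
  have "card (V - {v}) = 4" using noncut(1) order by simp
  then obtain a b c d where "induced_path4 (V - {v}) E F a b c d"
    using complementary_graphs.exists_induced_path4[OF delete_vertex[OF noncut(2,3)]] by blast
  then obtain a b c d where
    "induced_path4 (V - {v}) E F a b c d \<and> neighbors V E v \<in> path4_neighborhoods a b c d \<or>
     induced_path4 (V - {v}) F E a b c d \<and> neighbors V F v \<in> path4_neighborhoods a b c d"
    using exists_path4_neighborhood[OF noncut(1)] order by fastforce
  then have "(sum_colorable V E F 10 \<or> fork V E F) \<or> (sum_colorable V F E 10 \<or> fork V F E)"
    using sum_colorable_or_fork_path4_insert[OF noncut(1)]
      complementary_graphs.sum_colorable_or_fork_path4_insert[OF swapped noncut(1)] by blast
  then show ?thesis using sum_colorable_swap by blast
qed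

end

subsection \<open>Order six\<close>

context complementary_graphs
begin

context
  fixes p q r s t v
  assumes v_in: "v \<in> V" and fork: "fork_on (V - {v}) E F p q r s t"
begin

lemma fork_insert_vertices: "distinct [p, q, r, s, t, v]" "V = {p, q, r, s, t, v}"
  using fork v_in by (auto simp: fork_on_def)

lemma fork_insert_edges:
  "{{p, q}, {p, r}, {p, s}, {q, t}} \<subseteq> E"
  "{{p, t}, {q, r}, {q, s}, {r, s}, {r, t}, {s, t}} \<subseteq> F"
  using fork by (simp_all add: fork_on_def)

lemma embed_order_6:
  assumes "rainbow_colorable {..<6} G\<^sub>0 k" "\<And>e. e \<in> G\<^sub>0 \<Longrightarrow> e \<subseteq> {..<6}" "3 \<le> k"
    and "(`) ((!) vs) ` G\<^sub>0 \<subseteq> G" "vs \<in> {[p, q, r, s, t, v], [p, q, s, r, t, v]}"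
  shows "rainbow_colorable V G k"
proof -
  have "length vs = 6" "distinct vs" using assms(5) fork_insert_vertices(1) by auto
  moreover have "set vs = V"
    using assms(5) unfolding fork_insert_vertices(2)
    by (elim insertE) (simp_all add: insert_commute)
  ultimately show ?thesis using rainbow_colorable_embed[OF assms(1,2) _ _ assms(4,3)] by simp
qed

lemma fork_insert_colorable_8: "rainbow_colorable V E 8"
proof -
  have "{q, r, s} \<subseteq> neighbors V E p" "card {q, r, s} = 3" "card V = 6"
    using fork_insert_vertices fork_insert_edges(1) by (auto simp: neighbors_def)
  then show ?thesis
    using rainbow_colorable_neighbors[OF finite_vertices connected, of p "{q, r, s}"]
      fork_insert_vertices(2)
    by simp
qed

lemma cofork_insert_colorable_8: "rainbow_colorable V F 8"
proof -
  have "{q, s, t} \<subseteq> neighbors V F r" "card {q, s, t} = 3" "card V = 6"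
    using fork_insert_vertices fork_insert_edges(2) by (auto simp: neighbors_def insert_commute)
  then show ?thesis
    using rainbow_colorable_neighbors[OF finite_vertices connected_complement, of r "{q, s, t}"]
      fork_insert_vertices(2)
    by simp
qed

lemma fork_insert_colorable_7:
  assumes "{p, v} \<in> E \<or> {q, v} \<in> E"
  shows "rainbow_colorable V E 7"
  using assms
proof
  assume "{p, v} \<in> E"
  then have "{q, r, s, v} \<subseteq> neighbors V E p" "card {q, r, s, v} = 4" "card V = 6"
    using fork_insert_vertices fork_insert_edges(1) by (auto simp: neighbors_def)
  then show ?thesis
    using rainbow_colorable_neighbors[OF finite_vertices connected, of p "{q, r, s, v}"]
      fork_insert_vertices(2)
    by simp
next
  assume "{q, v} \<in> E"
  then show ?thesis
    using fork_insert_edges(1)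
    by (intro embed_order_6[OF rainbow_colorable_double_star, of "[p, q, r, s, t, v]"]) auto
qed

lemma cofork_insert_colorable_4:
  assumes "{p, v} \<in> F" "{q, v} \<in> F"
  shows "rainbow_colorable V F 4"
  using assms fork_insert_edges(2)
  by (intro embed_order_6[OF rainbow_colorable_cofork_pentagon, of "[p, q, r, s, t, v]"]) auto

lemma cofork_insert_colorable_5:
  assumes "{t, v} \<in> F \<or> {r, v} \<in> F \<or> {s, v} \<in> F"
  shows "rainbow_colorable V F 5"
  using assms
proof (elim disjE)
  assume "{t, v} \<in> F"
  then show ?thesis
    using fork_insert_edges(2)
    by (intro embed_order_6[OF rainbow_colorable_cofork_pendant_tip, of "[p, q, r, s, t, v]"]) auto
next
  assume "{r, v} \<in> F"
  then show ?thesis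
    using fork_insert_edges(2)
    by (intro embed_order_6[OF rainbow_colorable_cofork_pendant_side, of "[p, q, r, s, t, v]"]) auto
next
  assume "{s, v} \<in> F"
  then show ?thesis
    using fork_insert_edges(2)
    by (intro embed_order_6[OF rainbow_colorable_cofork_pendant_side, of "[p, q, s, r, t, v]"])
      (auto simp: insert_commute)
qed

lemma fork_insert_colorable_4:
  assumes "{p, v} \<in> E \<or> {q, v} \<in> E" and "{r, v} \<in> E" "{s, v} \<in> E" "{t, v} \<in> E"
  shows "rainbow_colorable V E 4"
  using assms(1)
proof
  assume "{p, v} \<in> E"
  then show ?thesis
    using assms(2-) fork_insert_edges(1)
    by (intro embed_order_6[OF rainbow_colorable_fork_joined_except_neighbor,
        of "[p, q, r, s, t, v]"]) auto
next
  assume "{q, v} \<in> E"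
  then show ?thesis
    using assms(2-) fork_insert_edges(1)
    by (intro embed_order_6[OF rainbow_colorable_fork_joined_except_center,
        of "[p, q, r, s, t, v]"]) auto
qed

end

lemma sum_colorable_fork_insert:
  assumes v_in: "v \<in> V" and "fork (V - {v}) E F"
  shows "sum_colorable V E F 12"
proof -
  obtain p q r s t where fork: "fork_on (V - {v}) E F p q r s t"
    using assms(2) unfolding fork_def by blast
  have complement: "{x, v} \<in> F \<longleftrightarrow> {x, v} \<notin> E" if "x \<in> {p, q, r, s, t}" for x
    using that fork v_in by (intro complement_iff) (auto simp: fork_on_def)
  consider (nonadjacent_to_inner) "{p, v} \<in> F" "{q, v} \<in> F"
    | (nonadjacent_to_leaf) "{p, v} \<in> E \<or> {q, v} \<in> E" "{t, v} \<in> F \<or> {r, v} \<in> F \<or> {s, v} \<in> F"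
    | (adjacent_to_leaves) "{p, v} \<in> E \<or> {q, v} \<in> E" "{r, v} \<in> E" "{s, v} \<in> E" "{t, v} \<in> E"
    using complement by blast
  then show ?thesis
  proof cases
    case nonadjacent_to_inner
    show ?thesis
      using fork_insert_colorable_8[OF v_in fork]
        cofork_insert_colorable_4[OF v_in fork nonadjacent_to_inner]
      by (rule sum_colorableI) simp
  next
    case nonadjacent_to_leaf
    show ?thesis
      using fork_insert_colorable_7[OF v_in fork nonadjacent_to_leaf(1)]
        cofork_insert_colorable_5[OF v_in fork nonadjacent_to_leaf(2)]
      by (rule sum_colorableI) simp
  next
    case adjacent_to_leaves
    show ?thesis
      using fork_insert_colorable_4[OF v_in fork adjacent_to_leaves]
        cofork_insert_colorable_8[OF v_in fork]
      by (rule sum_colorableI) simp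
  qed
qed

subsection \<open>The upper bound\<close>

lemma sum_colorable_step:
  assumes reducible: "reducible V E F v" and order: "6 \<le> card V"
    and rest: "7 \<le> card V \<Longrightarrow> sum_colorable (V - {v}) E F (2 * (card V - 1))"
  shows "sum_colorable V E F (2 * card V)"
proof (cases "card V = 6")
  case False
  then show ?thesis using sum_colorable_reducible[OF reducible _ rest] order by simp
next
  case True
  have noncut: "v \<in> V" "connected_graph (V - {v}) E" "connected_graph (V - {v}) F"
    using reducible by (simp_all add: reducible_def)
  have "card (V - {v}) = 5" using noncut(1) True by simp
  then consider (regular) "sum_colorable (V - {v}) E F 10"
    | (fork) "fork (V - {v}) E F" | (cofork) "fork (V - {v}) F E"
    using complementary_graphs.sum_colorable_order_5[OF delete_vertex[OF noncut(2,3)]] by blast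
  then show ?thesis
  proof cases
    case regular
    then show ?thesis using sum_colorable_reducible[OF reducible] True by simp
  next
    case fork
    then show ?thesis using sum_colorable_fork_insert[OF noncut(1)] True by simp
  next
    case cofork
    then show ?thesis
      using complementary_graphs.sum_colorable_fork_insert[OF swapped noncut(1)]
        sum_colorable_swap True
      by fastforce
  qed
qed

end

lemma sum_colorable_upper_bound:
  assumes "complementary_graphs V E F" "6 \<le> card V"
  shows "sum_colorable V E F (2 * card V)"
  using assms
proof (induction "card V" arbitrary: V E F rule: less_induct)
  case less
  have step: "sum_colorable V E F (2 * card V)"
    if graphs: "complementary_graphs V E F" and reducible: "reducible V E F v" for E F v
  proof (rule complementary_graphs.sum_colorable_step[OF graphs reducible less.prems(2)])
    assume order: "7 \<le> card V"
    have noncut: "v \<in> V" "connected_graph (V - {v}) E" "connected_graph (V - {v}) F"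
      using reducible by (simp_all add: reducible_def)
    have "card (V - {v}) = card V - 1" using noncut(1) by simp
    then show "sum_colorable (V - {v}) E F (2 * (card V - 1))"
      using less.hyps[OF _ complementary_graphs.delete_vertex[OF graphs noncut(2,3)]] order by simp
  qed
  obtain v where "reducible V E F v \<or> reducible V F E v"
    using complementary_graphs.exists_reducible[OF less.prems(1)] less.prems(2) by auto
  then show ?case
    using step[OF less.prems(1)] step[OF complementary_graphs.swapped[OF less.prems(1)]]
      sum_colorable_swap by blast
qed

subsection \<open>Bounds on the total-rainbow connection number\<close>

lemma trc_le:
  assumes "rainbow_colorable V E k"
  shows "trc V E \<le> k"
proof -
  obtain c where coloring: "total_rainbow_connected V E c" "\<And>z. c z < k"
    using assms unfolding rainbow_colorable_def by blast
  have "trc V E \<le> card (colors_used V E c)"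
    unfolding trc_def by (rule Least_le) (use coloring in blast)
  also have "\<dots> \<le> card {..<k}"
    by (rule card_mono) (use coloring(2) in \<open>auto simp: colors_used_def\<close>)
  finally show ?thesis by simp
qed

lemma trc_sum_le: "sum_colorable V E F s \<Longrightarrow> trc V E + trc V F \<le> s"
  unfolding sum_colorable_def by (meson add_mono order_trans trc_le)

lemma rainbow_colorable_connected:
  assumes "finite V" "connected_graph V E"
  shows "rainbow_colorable V E (2 * card V - 1)"
proof -
  obtain x where x_in: "x \<in> V" using assms(2) by (auto simp: connected_graph_def)
  have "rainbow_colorable {x} E 1"
    unfolding rainbow_colorable_def total_rainbow_connected_def incidence_proper_def neighbors_def
    by (intro exI[of _ "\<lambda>_. 0"]) simp
  from rainbow_colorable_grow[OF assms this] x_in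
  have "rainbow_colorable V E (1 + 2 * card (V - {x}))" by simp
  moreover have "1 \<le> card V" using assms(1) x_in by (auto simp: Suc_le_eq card_gt_0_iff)
  then have "1 + 2 * card (V - {x}) = 2 * card V - 1" using x_in by simp
  ultimately show ?thesis by simp
qed

lemma trc_attained:
  assumes "simple_graph V E" "connected_graph V E"
  obtains c where "total_rainbow_connected V E c" "card (colors_used V E c) = trc V E"
    "finite (colors_used V E c)"
proof -
  have "\<exists>k c. total_rainbow_connected V E c \<and> card (colors_used V E c) = k"
    using rainbow_colorable_connected[OF _ assms(2)] assms(1)
    unfolding rainbow_colorable_def simple_graph_def by blast
  then have "\<exists>c. total_rainbow_connected V E c \<and> card (colors_used V E c) = trc V E"
    unfolding trc_def by (rule LeastI_ex)
  moreover have "E \<subseteq> Pow V" "finite V" using assms(1) by (auto simp: simple_graph_def)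
  then have "finite (colors_used V E c)" for c
    unfolding colors_used_def by (meson finite_Pow_iff finite_UnI finite_imageI finite_subset)
  ultimately show ?thesis using that by blast
qed

lemma path_items_colors_used:
  "path_between V E u p v \<Longrightarrow> c ` path_items p \<subseteq> colors_used V E c"
  unfolding colors_used_def by (intro image_mono path_items_subset)

lemma card_path_items:
  assumes "total_rainbow c p"
  shows "card (c ` path_items p) = (length p - 1) + (length p - 2)"
proof -
  let ?items = "map Inr (path_edges p) @ map Inl (internal_vertices p)"
  have "c ` path_items p = set (map c ?items)" by (simp add: path_items_def image_Un image_image)
  also have "card \<dots> = length ?items"
    using assms unfolding total_rainbow_def by (metis distinct_card length_map)
  finally show ?thesis by (simp add: length_path_edges internal_vertices_def)
qed

lemma trc_ge_path_length:
  assumes graph: "simple_graph V E" "connected_graph V E" and endpoints: "u \<in> V" "v \<in> V" "u \<noteq> v"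
    and len: "\<And>p. path_between V E u p v \<Longrightarrow> l \<le> length p"
  shows "2 * l - 3 \<le> trc V E"
proof -
  obtain c where coloring: "total_rainbow_connected V E c" "card (colors_used V E c) = trc V E"
    "finite (colors_used V E c)" using graph by (rule trc_attained)
  obtain p where path: "path_between V E u p v" "total_rainbow c p"
    using coloring(1) endpoints unfolding total_rainbow_connected_def by blast
  have "2 * l - 3 \<le> (length p - 1) + (length p - 2)" using len[OF path(1)] by linarith
  also have "\<dots> \<le> card (colors_used V E c)"
    using card_mono[OF coloring(3) path_items_colors_used[OF path(1)]] card_path_items[OF path(2)]
    by simp
  finally show ?thesis using coloring(2) by simp
qed

definition unavoidable :: "'a set \<Rightarrow> 'a set set \<Rightarrow> 'a \<Rightarrow> 'a \<Rightarrow> 'a + 'a set \<Rightarrow> bool" where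
  "unavoidable V E u v z \<longleftrightarrow> (\<forall>p. path_between V E u p v \<longrightarrow> z \<in> path_items p)"

lemma unavoidable_bridge:
  assumes "u \<in> S" "v \<notin> S" "\<And>x y. x \<in> S \<Longrightarrow> y \<in> V - S \<Longrightarrow> {x, y} \<in> E \<Longrightarrow> {x, y} = e"
  shows "unavoidable V E u v (Inr e)"
  unfolding unavoidable_def
proof (intro allI impI)
  fix p assume path: "path_between V E u p v"
  obtain x y where "x \<in> S" "y \<in> V - S" "{x, y} \<in> set (path_edges p)" "{x, y} \<in> E"
    using path assms(1,2) by (rule path_between_crosses)
  then show "Inr e \<in> path_items p" using assms(3)[of x y] by (simp add: path_items_def)
qed

lemma unavoidable_endpoint:
  assumes "unavoidable V E u v (Inr e)" "x \<in> e" "x \<noteq> u" "x \<noteq> v"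
  shows "unavoidable V E u v (Inl x)"
  unfolding unavoidable_def
proof (intro allI impI)
  fix p assume path: "path_between V E u p v"
  then have "e \<in> set (path_edges p)" using assms(1) by (auto simp: unavoidable_def path_items_def)
  then have "x \<in> set p" using assms(2) path_edges_subset by fast
  then show "Inl x \<in> path_items p"
    using assms(3,4) by (simp add: path_items_def set_internal_vertices[OF path])
qed

lemma trc_ge_unavoidable:
  assumes graph: "simple_graph V E" "connected_graph V E" and items: "A \<subseteq> Inl ` V \<union> Inr ` E"
    and pair: "\<And>z z'. z \<in> A \<Longrightarrow> z' \<in> A \<Longrightarrow> z \<noteq> z' \<Longrightarrow>
      \<exists>u\<in>V. \<exists>v\<in>V. u \<noteq> v \<and> unavoidable V E u v z \<and> unavoidable V E u v z'"
  shows "card A \<le> trc V E"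
proof -
  obtain c where coloring: "total_rainbow_connected V E c" "card (colors_used V E c) = trc V E"
    "finite (colors_used V E c)" using graph by (rule trc_attained)
  have "c z \<noteq> c z'" if distinct_items: "z \<in> A" "z' \<in> A" "z \<noteq> z'" for z z'
  proof -
    obtain u v where endpoints: "u \<in> V" "v \<in> V" "u \<noteq> v"
      "unavoidable V E u v z" "unavoidable V E u v z'" using pair[OF distinct_items] by blast
    then obtain p where path: "path_between V E u p v" "total_rainbow c p"
      using coloring(1) unfolding total_rainbow_connected_def by blast
    then have "z \<in> path_items p" "z' \<in> path_items p"
      using endpoints(4,5) by (auto simp: unavoidable_def)
    then show ?thesis
      using path(2) distinct_items(3) by (auto simp: total_rainbow_iff_inj_on dest: inj_onD)
  qed
  then have "inj_on c A" by (auto intro: inj_onI)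
  then have "card A = card (c ` A)" by (simp add: card_image)
  also have "\<dots> \<le> card (colors_used V E c)"
    using coloring(3) items by (intro card_mono) (auto simp: colors_used_def)
  finally show ?thesis using coloring(2) by simp
qed

subsection \<open>Graphs of orders four and five\<close>

lemma simple_graph_complement: "simple_graph V E \<Longrightarrow> simple_graph V (complement_edges V E)"
  by (simp add: simple_graph_def complement_edges_def)

lemma complementary_graphs_complement_edges:
  assumes "simple_graph V E" "connected_graph V E" "connected_graph V (complement_edges V E)"
  shows "complementary_graphs V E (complement_edges V E)"
  by unfold_locales (use assms in \<open>simp_all add: simple_graph_def complement_edges_def\<close>)

lemma (in complementary_graphs) trc_induced_path4:
  assumes graph: "simple_graph V E" and path: "induced_path4 V E F a b c d"
  shows "trc V E = 5"
proof (rule antisym)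
  have vertices: "distinct [a, b, c, d]" "V = {a, b, c, d}"
    and edges: "{{a, b}, {b, c}, {c, d}} \<subseteq> E" and non_edges_F: "{{a, c}, {a, d}, {b, d}} \<subseteq> F"
    using path by (simp_all add: induced_path4_def)
  have "{a, c} \<subseteq> neighbors V E b" "card {a, c} = 2" "card V = 4"
    using vertices edges by (auto simp: neighbors_def insert_commute)
  then have "rainbow_colorable V E 5"
    using rainbow_colorable_neighbors[OF finite_vertices connected, of b "{a, c}"] vertices(2)
    by simp
  then show "trc V E \<le> 5" by (rule trc_le)
  have non_edges: "{a, c} \<notin> E" "{a, d} \<notin> E" "{b, d} \<notin> E"
    using complement_iff[of a] complement_iff[of b d] vertices non_edges_F by auto
  have "{x, d} \<notin> E" if "{a, x} \<in> E" for x
  proof -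
    have "x \<in> V" "x \<noteq> a" using graph that by (auto simp: simple_graph_def)
    then have "x = b" using that vertices(2) non_edges(1,2) by auto
    then show ?thesis using non_edges(3) by simp
  qed
  then have "4 \<le> length p" if "path_between V E a p d" for p
    using path_length_ge_4[OF that _ non_edges(2)] vertices(1) by auto
  then have "2 * 4 - 3 \<le> trc V E"
    by (rule trc_ge_path_length[OF graph connected, rotated 3]) (use vertices in auto)
  then show "5 \<le> trc V E" by simp
qed

lemma trc_sum_order_4:
  assumes graphs: "simple_graph V E" "complementary_graphs V E (complement_edges V E)"
    and order: "card V = 4"
  shows "trc V E + trc V (complement_edges V E) = 10"
proof -
  let ?F = "complement_edges V E"
  obtain a b c d where path: "induced_path4 V E ?F a b c d"
    using complementary_graphs.exists_induced_path4[OF graphs(2) order] by blast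
  have "trc V E = 5"
    using graphs path by (intro complementary_graphs.trc_induced_path4)
  moreover have "trc V ?F = 5"
    using induced_path4_complement[OF path] simple_graph_complement[OF graphs(1)]
    by (intro complementary_graphs.trc_induced_path4[OF complementary_graphs.swapped[OF graphs(2)]])
  ultimately show ?thesis by simp
qed

lemma (in complementary_graphs) trc_sum_order_5:
  assumes "card V = 5"
  shows "trc V E + trc V F \<le> 11"
proof -
  consider (regular) "sum_colorable V E F 10" | (fork) "fork V E F" | (cofork) "fork V F E"
    using sum_colorable_order_5[OF assms] by blast
  then show ?thesis
  proof cases
    case regular
    then show ?thesis using trc_sum_le by fastforce
  next
    case fork
    then show ?thesis by (rule trc_sum_le[OF sum_colorable_fork])
  next
    case cofork
    then have "sum_colorable V F E 11" by (rule complementary_graphs.sum_colorable_fork[OF swapped])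
    then show ?thesis by (rule trc_sum_le[OF sum_colorable_swap])
  qed
qed

subsection \<open>Paths attain the bound\<close>

definition path_graph :: "nat \<Rightarrow> nat set set" where
  "path_graph n = {{i, Suc i} | i. Suc i < n}"

lemma path_graph_edge_iff: "{i, j} \<in> path_graph n \<longleftrightarrow> i < n \<and> j < n \<and> (j = Suc i \<or> i = Suc j)"
  by (auto simp: path_graph_def doubleton_eq_iff)

lemma path_graph_complement_edge_iff:
  "{i, j} \<in> complement_edges {..<n} (path_graph n) \<longleftrightarrow>
    i < n \<and> j < n \<and> i \<noteq> j \<and> j \<noteq> Suc i \<and> i \<noteq> Suc j"
  by (auto simp: complement_edges_def path_graph_edge_iff card_insert_if)

lemma simple_path_graph: "simple_graph {..<n} (path_graph n)"
  by (auto simp: simple_graph_def path_graph_def)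

lemma connected_path_graph:
  assumes "0 < n"
  shows "connected_graph {..<n} (path_graph n)"
proof -
  have "connected_graph {..<m} (path_graph n)" if "1 \<le> m" "m \<le> n" for m
    using that
  proof (induction m rule: dec_induct)
    case base
    then show ?case using connected_graph_singleton[of 0] by (simp add: lessThan_Suc)
  next
    case (step m)
    then show ?case
      using connected_graph_insert[of "{..<m}" "path_graph n" "m - 1" m]
      by (simp add: lessThan_Suc path_graph_edge_iff)
  qed
  then show ?thesis using assms by simp
qed

lemma connected_path_graph_complement:
  assumes n_ge: "4 \<le> n"
  shows "connected_graph {..<n} (complement_edges {..<n} (path_graph n))"
proof -
  let ?F = "complement_edges {..<n} (path_graph n)"
  have "connected_graph ({..<n} - {1}) ?F"
    by (rule connected_graph_dominating[OF connected_graph_singleton[of 0]])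
      (use n_ge in \<open>auto simp: path_graph_complement_edge_iff\<close>)
  then have "connected_graph (insert 1 ({..<n} - {1})) ?F"
    by (rule connected_graph_insert[of _ _ 3])
      (use n_ge in \<open>auto simp: path_graph_complement_edge_iff\<close>)
  then show ?thesis using n_ge by (simp add: insert_absorb)
qed

lemma path_graph_path_length:
  assumes path: "path_between {..<n} (path_graph n) 0 p (n - 1)"
  shows "n \<le> length p"
proof -
  have "i \<in> set p" if "i < n" for i
  proof (cases "i = n - 1")
    case True
    then show ?thesis using path by (metis last_in_set path_between_def)
  next
    case False
    then have "unavoidable {..<n} (path_graph n) 0 (n - 1) (Inr {i, Suc i})"
      by (intro unavoidable_bridge[of _ "{..i}"]) (use that in \<open>auto simp: path_graph_edge_iff\<close>)
    then have "{i, Suc i} \<in> set (path_edges p)"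
      using path by (auto simp: unavoidable_def path_items_def)
    then show ?thesis using path_edges_subset by blast
  qed
  then have "card {..<n} \<le> card (set p)" by (intro card_mono) auto
  then show ?thesis using card_length[of p] by simp
qed

lemma trc_sum_path_graph:
  assumes n_ge: "6 \<le> n"
  shows "trc {..<n} (path_graph n) + trc {..<n} (complement_edges {..<n} (path_graph n)) = 2 * n"
proof (rule antisym)
  let ?F = "complement_edges {..<n} (path_graph n)"
  have connected: "connected_graph {..<n} (path_graph n)" "connected_graph {..<n} ?F"
    using n_ge by (auto intro: connected_path_graph connected_path_graph_complement)
  have simple: "simple_graph {..<n} ?F"
    by (rule simple_graph_complement[OF simple_path_graph])
  have "sum_colorable {..<n} (path_graph n) ?F (2 * card {..<n})"
    using n_ge
    by (intro sum_colorable_upper_bound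
        complementary_graphs_complement_edges[OF simple_path_graph connected]) simp
  then show "trc {..<n} (path_graph n) + trc {..<n} ?F \<le> 2 * n"
    using trc_sum_le by fastforce
  have "2 * n - 3 \<le> trc {..<n} (path_graph n)"
    using n_ge path_graph_path_length
    by (intro trc_ge_path_length[OF simple_path_graph connected(1), of 0 "n - 1"]) auto
  moreover have "2 * 3 - 3 \<le> trc {..<n} ?F"
  proof (rule trc_ge_path_length[OF simple connected(2), of 0 1])
    show "3 \<le> length p" if "path_between {..<n} ?F 0 p 1" for p
      using that by (rule path_length_ge_3) (simp_all add: path_graph_complement_edge_iff)
  qed (use n_ge in auto)
  ultimately show "2 * n \<le> trc {..<n} (path_graph n) + trc {..<n} ?F" by simp
qed

subsection \<open>The fork attains the bound\<close>

definition fork_edges :: "nat set set" where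
  "fork_edges = {{0, 1}, {0, 2}, {0, 3}, {1, 4}}"

definition cofork_edges :: "nat set set" where
  "cofork_edges = {{0, 4}, {1, 2}, {1, 3}, {2, 3}, {2, 4}, {3, 4}}"

lemma fork_edge_iff:
  "{x, y} \<in> fork_edges \<longleftrightarrow>
    (x, y) \<in> {(0, 1), (1, 0), (0, 2), (2, 0), (0, 3), (3, 0), (1, 4), (4, 1)}"
  by (auto simp: fork_edges_def doubleton_eq_iff)

lemma cofork_edge_iff:
  "{x, y} \<in> cofork_edges \<longleftrightarrow>
    (x, y) \<in> {(0, 4), (4, 0), (1, 2), (2, 1), (1, 3), (3, 1), (2, 3), (3, 2),
      (2, 4), (4, 2), (3, 4), (4, 3)}"
  by (auto simp: cofork_edges_def doubleton_eq_iff)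

lemma complement_fork_edges: "complement_edges {..<5} fork_edges = cofork_edges"
proof
  have "{x, y} \<in> cofork_edges"
    if "x \<in> {..<5}" "y \<in> {..<5}" "x \<noteq> y" "{x, y} \<notin> fork_edges" for x y
    using that unfolding lessThan_5 fork_edge_iff cofork_edge_iff
    by (elim insertE emptyE; simp)
  then show "complement_edges {..<5} fork_edges \<subseteq> cofork_edges"
    by (auto simp: complement_edges_def card_2_iff)
  show "cofork_edges \<subseteq> complement_edges {..<5} fork_edges"
    by (simp add: complement_edges_def fork_edges_def cofork_edges_def doubleton_eq_iff)
qed

lemma simple_fork: "simple_graph {..<5} fork_edges"
  by (simp add: simple_graph_def fork_edges_def)

lemma connected_fork: "connected_graph {..<5} fork_edges"
proof -
  have "connected_graph {0, 1, 2, 3} fork_edges"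
    by (rule connected_graph_dominating[OF connected_graph_singleton[of 0]])
      (auto simp: fork_edge_iff)
  then have "connected_graph (insert 4 {0, 1, 2, 3}) fork_edges"
    by (rule connected_graph_insert[of _ _ 1]) (auto simp: fork_edge_iff)
  then show ?thesis by (simp add: lessThan_5 insert_commute)
qed

lemma connected_cofork: "connected_graph {..<5} cofork_edges"
proof -
  have "connected_graph {4, 0, 2, 3} cofork_edges"
    by (rule connected_graph_dominating[OF connected_graph_singleton[of 4]])
      (auto simp: cofork_edge_iff)
  then have "connected_graph (insert 1 {4, 0, 2, 3}) cofork_edges"
    by (rule connected_graph_insert[of _ _ 2]) (auto simp: cofork_edge_iff)
  then show ?thesis by (simp add: lessThan_5 insert_commute)
qed

lemma trc_fork_ge: "6 \<le> trc {..<5} fork_edges"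
proof -
  let ?unavoidable = "unavoidable {..<5} fork_edges"
  define e\<^sub>2 e\<^sub>3 :: "nat + nat set" where "e\<^sub>2 = Inr {0, 2}" and "e\<^sub>3 = Inr {0, 3}"
  let ?common = "{Inr {0, 1}, Inr {1, 4}, Inl 0, Inl 1 :: nat + nat set}"
  have edge_2: "?unavoidable 2 v e\<^sub>2" if "v \<noteq> 2" for v
    unfolding e\<^sub>2_def
    by (rule unavoidable_bridge[of _ "{2}"]) (use that in \<open>auto simp: fork_edge_iff\<close>)
  have edge_3: "?unavoidable 3 4 e\<^sub>3"
    unfolding e\<^sub>3_def by (rule unavoidable_bridge[of _ "{3}"]) (auto simp: fork_edge_iff)
  have edge_3_end: "?unavoidable 2 3 e\<^sub>3"
    unfolding e\<^sub>3_def by (rule unavoidable_bridge[of _ "- {3}"]) (auto simp: fork_edge_iff)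
  have edge_01: "?unavoidable u 4 (Inr {0, 1})" if "u \<in> {2, 3}" for u
    by (rule unavoidable_bridge[of _ "{0, 2, 3}"]) (use that in \<open>auto simp: fork_edge_iff\<close>)
  have edge_14: "?unavoidable u 4 (Inr {1, 4})" if "u \<in> {2, 3}" for u
    by (rule unavoidable_bridge[of _ "- {4}"]) (use that in \<open>auto simp: fork_edge_iff\<close>)
  have common: "?unavoidable u 4 z" if "u \<in> {2, 3}" "z \<in> ?common" for u z
    using that(2,1) edge_01[OF that(1)] edge_14[OF that(1)]
      unavoidable_endpoint[OF edge_01[OF that(1)]]
    by (elim insertE emptyE) auto
  have "card (insert e\<^sub>2 (insert e\<^sub>3 ?common)) \<le> trc {..<5} fork_edges"
  proof (rule trc_ge_unavoidable[OF simple_fork connected_fork])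
    show "insert e\<^sub>2 (insert e\<^sub>3 ?common) \<subseteq> Inl ` {..<5} \<union> Inr ` fork_edges"
      by (simp add: e\<^sub>2_def e\<^sub>3_def fork_edges_def)
    fix z z' assume items: "z \<in> insert e\<^sub>2 (insert e\<^sub>3 ?common)"
      "z' \<in> insert e\<^sub>2 (insert e\<^sub>3 ?common)" "z \<noteq> z'"
    have "?unavoidable 2 4 z \<and> ?unavoidable 2 4 z' \<or> ?unavoidable 3 4 z \<and> ?unavoidable 3 4 z' \<or>
        ?unavoidable 2 3 z \<and> ?unavoidable 2 3 z'"
      using items edge_2[of 3] edge_2[of 4] edge_3 edge_3_end common[of 2 z] common[of 2 z']
        common[of 3 z] common[of 3 z'] by auto
    moreover have "(2 :: nat) \<in> {..<5}" "(3 :: nat) \<in> {..<5}" "(4 :: nat) \<in> {..<5}"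
      "(2 :: nat) \<noteq> 4" "(3 :: nat) \<noteq> 4" "(2 :: nat) \<noteq> 3" by simp_all
    ultimately show "\<exists>u\<in>{..<5}. \<exists>v\<in>{..<5}. u \<noteq> v \<and> ?unavoidable u v z \<and> ?unavoidable u v z'"
      by metis
  qed
  moreover have "card (insert e\<^sub>2 (insert e\<^sub>3 ?common)) = 6"
    by (simp add: e\<^sub>2_def e\<^sub>3_def doubleton_eq_iff)
  ultimately show ?thesis by simp
qed

lemma trc_cofork_ge: "5 \<le> trc {..<5} cofork_edges"
proof -
  have "2 * 4 - 3 \<le> trc {..<5} cofork_edges"
  proof (rule trc_ge_path_length[OF _ connected_cofork, of 0 1])
    show "simple_graph {..<5} cofork_edges"
      using simple_graph_complement[OF simple_fork] by (simp add: complement_fork_edges)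
    show "4 \<le> length p" if "path_between {..<5} cofork_edges 0 p 1" for p
      using that by (rule path_length_ge_4) (auto simp: cofork_edge_iff)
  qed auto
  then show ?thesis by simp
qed

lemma trc_sum_fork: "trc {..<5} fork_edges + trc {..<5} cofork_edges = 11"
proof (rule antisym)
  have graphs: "complementary_graphs {..<5} fork_edges cofork_edges"
    using complementary_graphs_complement_edges[OF simple_fork connected_fork] connected_cofork
    by (simp add: complement_fork_edges)
  have "fork {..<5} fork_edges cofork_edges"
    unfolding fork_def fork_on_def fork_edges_def cofork_edges_def lessThan_5
    by (rule exI[of _ 0], rule exI[of _ 1], rule exI[of _ 2], rule exI[of _ 3], rule exI[of _ 4])
      simp
  then show "trc {..<5} fork_edges + trc {..<5} cofork_edges \<le> 11"
    by (rule trc_sum_le[OF complementary_graphs.sum_colorable_fork[OF graphs]])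
  show "11 \<le> trc {..<5} fork_edges + trc {..<5} cofork_edges"
    using trc_fork_ge trc_cofork_ge by linarith
qed

lemma exists_extremal_graph:
  assumes "5 \<le> n"
  shows "\<exists>(V :: nat set) E. simple_graph V E \<and> card V = n \<and>
    connected_graph V E \<and> connected_graph V (complement_edges V E) \<and>
    trc V E + trc V (complement_edges V E) = (if n = 5 then 2 * n + 1 else 2 * n)"
proof (cases "n = 5")
  case True
  then show ?thesis
    using simple_fork connected_fork connected_cofork trc_sum_fork
    by (intro exI[of _ "{..<5}"] exI[of _ fork_edges]) (simp add: complement_fork_edges)
next
  case False
  then show ?thesis
    using assms simple_path_graph connected_path_graph connected_path_graph_complement
      trc_sum_path_graph
    by (intro exI[of _ "{..<n}"] exI[of _ "path_graph n"]) simp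
qed

theorem theorem4p5:
  shows "(\<forall>(V :: 'a set) E n.
            simple_graph V E \<and> card V = n \<and> n \<ge> 4 \<and>
            connected_graph V E \<and> connected_graph V (complement_edges V E) \<longrightarrow>
              (n = 4 \<longrightarrow> trc V E + trc V (complement_edges V E) = 2 * n + 2) \<and>
              (n = 5 \<longrightarrow> trc V E + trc V (complement_edges V E) \<le> 2 * n + 1) \<and>
              (n \<ge> 6 \<longrightarrow> trc V E + trc V (complement_edges V E) \<le> 2 * n)) \<and>
         (\<forall>n \<ge> 5. \<exists>(V :: nat set) E.
            simple_graph V E \<and> card V = n \<and>
            connected_graph V E \<and> connected_graph V (complement_edges V E) \<and>
            trc V E + trc V (complement_edges V E) = (if n = 5 then 2 * n + 1 else 2 * n))"
proof (intro conjI allI impI)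
  fix V :: "'a set" and E n
  assume graph: "simple_graph V E \<and> card V = n \<and> n \<ge> 4 \<and>
    connected_graph V E \<and> connected_graph V (complement_edges V E)"
  then have graphs: "complementary_graphs V E (complement_edges V E)"
    by (intro complementary_graphs_complement_edges) auto
  show "trc V E + trc V (complement_edges V E) = 2 * n + 2" if "n = 4"
    using trc_sum_order_4[OF _ graphs] graph that by simp
  show "trc V E + trc V (complement_edges V E) \<le> 2 * n + 1" if "n = 5"
    using complementary_graphs.trc_sum_order_5[OF graphs] graph that by simp
  show "trc V E + trc V (complement_edges V E) \<le> 2 * n" if "n \<ge> 6"
    using trc_sum_le[OF sum_colorable_upper_bound[OF graphs]] graph that by simp
next
  fix n :: nat assume "5 \<le> n"
  then show "\<exists>(V :: nat set) E. simple_graph V E \<and> card V = n \<and>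
      connected_graph V E \<and> connected_graph V (complement_edges V E) \<and>
      trc V E + trc V (complement_edges V E) = (if n = 5 then 2 * n + 1 else 2 * n)"
    by (rule exists_extremal_graph)
qed

end
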